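(* Let $(G,g)$ be a semi-Riemannian Lie group with a semisimple subgroup $K=K_1\times\cdots\times K_n$ generating a left-invariant conformal foliation $\mathcal F$ on $G$. Let $\mathfrak g=\mathfrak k_1\oplus\cdots\oplus\mathfrak k_n\oplus\mathfrak m$ be an orthogonal decomposition of the Lie algebra $\mathfrak g$ of $G$, where $\mathfrak k_j$ is the Lie algebra of $K_j$ and $\mathfrak m$ is two-dimensional. For each $k$ let $\mathcal V_k$ be the integrable distribution generated by $\mathfrak k_k$, let $\mathcal V=\mathcal V_1\oplus\cdots\oplus\mathcal V_n$, and let $\mathcal H$ be its orthogonal complementary distribution, generated by $\mathfrak m$. Then for all $j\neq k$ we have $\mathcal V_j[\mathcal V_k,\mathcal H]=0$, i.e. the orthogonal projection onto $\mathcal V_j$ of $[E,F]$ vanishes for all $E\in\mathfrak k_k$ and $F\in\mathfrak m$.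
   Context: A semi-Riemannian Lie group $(G,g)$ is a Lie group with a left-invariant non-degenerate metric $g$ of arbitrary signature (with $\mathfrak m$ non-degenerate); its Lie algebra is identified with the left-invariant vector fields. $K$ generates the left-invariant foliation $\mathcal F$ by left translates of $K$, tangent to $\mathcal V$. With $\nabla$ the Levi-Civita connection and $\mathcal V$ also the orthogonal projection onto $\mathcal V$, $B^{\mathcal H}(E,F)=\tfrac12\mathcal V(\nabla_EF+\nabla_FE)$ for $E,F\in\mathcal H$; $\mathcal F$ is conformal if there is a vector field $V$ in $\mathcal V$ with $B^{\mathcal H}(E,F)=g(E,F)V$ for all $E,F\in\mathcal H$. *)

theory Defs
  imports "HOL-Analysis.Analysis"
begin

text \<open>Everything is left-invariant, so we work on the Lie algebra of G, modelled as a
finite-dimensional real vector space (type of class euclidean_space; its built-in inner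
product is NOT used) with a Lie bracket br and a left-invariant metric g.\<close>

definition lie_algebra :: "('a::real_vector \<Rightarrow> 'a \<Rightarrow> 'a) \<Rightarrow> bool" where
  "lie_algebra br \<longleftrightarrow> bilinear br \<and> (\<forall>x. br x x = 0) \<and>
     (\<forall>x y z. br x (br y z) + br y (br z x) + br z (br x y) = 0)"

definition semi_riem_metric :: "('a::real_vector \<Rightarrow> 'a \<Rightarrow> real) \<Rightarrow> bool" where
  "semi_riem_metric g \<longleftrightarrow> bilinear g \<and> (\<forall>x y. g x y = g y x) \<and>
     (\<forall>x. (\<forall>y. g x y = 0) \<longrightarrow> x = 0)"

definition lie_subalgebra :: "('a::real_vector \<Rightarrow> 'a \<Rightarrow> 'a) \<Rightarrow> 'a set \<Rightarrow> bool" where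
  "lie_subalgebra br S \<longleftrightarrow> subspace S \<and> (\<forall>x\<in>S. \<forall>y\<in>S. br x y \<in> S)"

definition lie_ideal_of :: "('a::real_vector \<Rightarrow> 'a \<Rightarrow> 'a) \<Rightarrow> 'a set \<Rightarrow> 'a set \<Rightarrow> bool" where
  "lie_ideal_of br S I \<longleftrightarrow> subspace I \<and> I \<subseteq> S \<and> (\<forall>x\<in>S. \<forall>y\<in>I. br x y \<in> I)"

fun derived_series :: "('a::real_vector \<Rightarrow> 'a \<Rightarrow> 'a) \<Rightarrow> 'a set \<Rightarrow> nat \<Rightarrow> 'a set" where
  "derived_series br I 0 = I"
| "derived_series br I (Suc m) =
     span {br x y | x y. x \<in> derived_series br I m \<and> y \<in> derived_series br I m}"

definition solvable_lie :: "('a::real_vector \<Rightarrow> 'a \<Rightarrow> 'a) \<Rightarrow> 'a set \<Rightarrow> bool" where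
  "solvable_lie br I \<longleftrightarrow> (\<exists>m. derived_series br I m = {0})"

definition semisimple_lie :: "('a::real_vector \<Rightarrow> 'a \<Rightarrow> 'a) \<Rightarrow> 'a set \<Rightarrow> bool" where
  "semisimple_lie br S \<longleftrightarrow> lie_subalgebra br S \<and>
     (\<forall>I. lie_ideal_of br S I \<and> solvable_lie br I \<longrightarrow> I = {0})"

text \<open>Levi-Civita connection on left-invariant fields, via the Koszul formula.\<close>
definition lc_nabla :: "('a::real_vector \<Rightarrow> 'a \<Rightarrow> 'a) \<Rightarrow> ('a \<Rightarrow> 'a \<Rightarrow> real) \<Rightarrow> 'a \<Rightarrow> 'a \<Rightarrow> 'a" where
  "lc_nabla br g X Y = (THE Z. \<forall>W. 2 * g Z W = g (br X Y) W - g (br Y W) X + g (br W X) Y)"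

definition orth_proj :: "('a::real_vector \<Rightarrow> 'a \<Rightarrow> real) \<Rightarrow> 'a set \<Rightarrow> 'a \<Rightarrow> 'a" where
  "orth_proj g S x = (THE y. y \<in> S \<and> (\<forall>z\<in>S. g (x - y) z = 0))"

definition sum_spaces :: "(nat \<Rightarrow> 'a::real_vector set) \<Rightarrow> nat \<Rightarrow> 'a set" where
  "sum_spaces k n = {\<Sum>j<n. xs j | xs. \<forall>j<n. xs j \<in> k j}"

text \<open>Second fundamental form of the horizontal distribution H (spanned by m),
  with vertical space Vsp.\<close>
definition BH :: "('a::real_vector \<Rightarrow> 'a \<Rightarrow> 'a) \<Rightarrow> ('a \<Rightarrow> 'a \<Rightarrow> real) \<Rightarrow> 'a set \<Rightarrow> 'a \<Rightarrow> 'a \<Rightarrow> 'a" where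
  "BH br g Vsp E F = (1/2) *\<^sub>R orth_proj g Vsp (lc_nabla br g E F + lc_nabla br g F E)"

definition conformal_foliation ::
  "('a::real_vector \<Rightarrow> 'a \<Rightarrow> 'a) \<Rightarrow> ('a \<Rightarrow> 'a \<Rightarrow> real) \<Rightarrow> 'a set \<Rightarrow> 'a set \<Rightarrow> bool" where
  "conformal_foliation br g Vsp m \<longleftrightarrow>
     (\<exists>V\<in>Vsp. \<forall>E\<in>m. \<forall>F\<in>m. BH br g Vsp E F = g E F *\<^sub>R V)"

end

theory Submission
  imports Defs
    "HOL-Computational_Algebra.Field_as_Ring"
    "HOL-Computational_Algebra.Polynomial_Factorial"
    "HOL-Computational_Algebra.Fundamental_Theorem_Algebra"
begin

text \<open>
  Write \<open>K\<close> for the sum of the \<open>k\<^sub>j\<close>. Modulo \<open>K\<close>, each \<open>ad W\<close> with \<open>W \<in> K\<close> acts on the plane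
  \<open>m\<close>, and conformality says that it acts by a conformal endomorphism. Conformal endomorphisms of
  a nondegenerate plane commute, so \<open>[K, K]\<close> acts trivially; as \<open>K\<close> is perfect, \<open>[K, m] \<subseteq> K\<close>. Hence
  every \<open>F \<in> m\<close> acts on \<open>K\<close> by a derivation, and a derivation preserves each ideal \<open>k\<^sub>l\<close> because
  \<open>k\<^sub>l = [k\<^sub>l, k\<^sub>l]\<close>. So \<open>[k\<^sub>l, m] \<subseteq> k\<^sub>l\<close>, which is orthogonal to \<open>k\<^sub>j\<close>.

  That a Lie algebra without solvable ideals is perfect is the substantial input. It follows from
  nondegeneracy on \<open>K\<close> of the form \<open>tr (ad x ad y)\<close>, the trace being taken on the whole ambient Lie
  algebra. If \<open>S\<close> is the radical of this form and \<open>x \<in> [S, S]\<close>, then pairing \<open>D = ad x\<close>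
  with the derivation that acts by the conjugate eigenvalue on each generalized eigenspace of \<open>D\<close>
  gives \<open>0 = \<Sum> \<bar>\<lambda>\<bar>\<^sup>2\<close>, so \<open>D\<close> is nilpotent; by Engel's theorem \<open>S\<close> is solvable, hence zero.
\<close>

section \<open>Traces of endomorphisms\<close>

text \<open>The scalar multiplication is a parameter because the complexification will live on
  \<open>'a \<times> 'a\<close>, whose type class structure is that of a real vector space.\<close>

locale complex_fdvs = finite_dimensional_vector_space scale Basis
  for scale :: "complex \<Rightarrow> 'b::ab_group_add \<Rightarrow> 'b" (infixr \<open>*\<^sub>C\<close> 75) and Basis
begin

abbreviation endo :: "('b \<Rightarrow> 'b) \<Rightarrow> bool" where
  "endo \<equiv> module_hom scale scale"

text \<open>For independent \<open>C\<close> with \<open>f\<close> preserving \<open>span C\<close>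
  this is the trace of the restriction of \<open>f\<close>. Allowing proper subspaces lets traces be
  computed on ranges.\<close>

definition tr_on :: "'b set \<Rightarrow> ('b \<Rightarrow> 'b) \<Rightarrow> complex" where
  "tr_on C f = (\<Sum>c\<in>C. representation C (f c) c)"

abbreviation tr :: "('b \<Rightarrow> 'b) \<Rightarrow> complex" where
  "tr \<equiv> tr_on Basis"

lemma endoI:
  assumes "\<And>x y. f (x + y) = f x + f y" "\<And>c x. f (c *\<^sub>C x) = c *\<^sub>C f x"
  shows "endo f"
  using assms module_axioms by (simp add: module_hom_def module_hom_axioms_def)

lemma endo_compose: "endo f \<Longrightarrow> endo h \<Longrightarrow> endo (\<lambda>v. f (h v))"
  by (rule endoI) (simp_all add: module_hom.add module_hom.scale)

lemma endo_funpow: "endo f \<Longrightarrow> endo (f ^^ i)"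
proof (induction i)
  case 0
  show ?case by (rule endoI) simp_all
next
  case (Suc i)
  then show ?case using endo_compose[of f "f ^^ i"] by (simp add: comp_def)
qed

lemma representation_combination:
  assumes C: "independent C" and A: "\<And>a. a \<in> A \<Longrightarrow> v a \<in> span C"
  shows "representation C (\<Sum>a\<in>A. u a *\<^sub>C v a) c = (\<Sum>a\<in>A. u a * representation C (v a) c)"
  using assms by (simp add: representation_sum representation_scale span_scale)

text \<open>Expanding the vectors of \<open>C\<close> in \<open>C'\<close> and the images of
  \<open>C'\<close> in \<open>C\<close> turns both traces into the same double sum.\<close>

lemma tr_on_eq_if_span_eq:
  assumes C: "independent C" "independent C'" and sp: "span C' = span C"
    and f: "endo f" and inv: "\<And>v. v \<in> span C \<Longrightarrow> f v \<in> span C"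
  shows "tr_on C f = tr_on C' f"
proof -
  have fin: "finite C" "finite C'" using C finiteI_independent by auto
  have inC: "\<And>d. d \<in> C' \<Longrightarrow> f d \<in> span C" "\<And>c. c \<in> C \<Longrightarrow> c \<in> span C'"
    using inv sp span_base by auto
  have 1: "representation C (f c) c
      = (\<Sum>d\<in>C'. representation C' c d * representation C (f d) c)" if "c \<in> C" for c
  proof -
    have "f c = f (\<Sum>d\<in>C'. representation C' c d *\<^sub>C d)"
      using sum_representation_eq[OF C(2) inC(2)[OF that] fin(2)] by simp
    also have "\<dots> = (\<Sum>d\<in>C'. representation C' c d *\<^sub>C f d)"
      by (simp add: module_hom.sum[OF f] module_hom.scale[OF f])
    finally show ?thesis using representation_combination[OF C(1), of C' f] inC by simp
  qed
  have 2: "representation C' (f d) d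
      = (\<Sum>c\<in>C. representation C (f d) c * representation C' c d)" if "d \<in> C'" for d
  proof -
    have "representation C' (f d) d
        = representation C' (\<Sum>c\<in>C. representation C (f d) c *\<^sub>C c) d"
      by (simp only: sum_representation_eq[OF C(1) inC(1)[OF that] fin(1) order_refl])
    also have "\<dots> = (\<Sum>c\<in>C. representation C (f d) c * representation C' c d)"
      by (rule representation_combination[OF C(2) inC(2)])
    finally show ?thesis .
  qed
  have "tr_on C f = (\<Sum>c\<in>C. \<Sum>d\<in>C'. representation C' c d * representation C (f d) c)"
    unfolding tr_on_def using 1 by simp
  also have "\<dots> = (\<Sum>d\<in>C'. \<Sum>c\<in>C. representation C' c d * representation C (f d) c)"
    by (rule sum.swap)
  also have "\<dots> = tr_on C' f"
    unfolding tr_on_def using 2 by (simp add: mult.commute)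
  finally show ?thesis .
qed

text \<open>Extend \<open>C'\<close> to a basis \<open>E\<close> of \<open>span C\<close>. Since
  \<open>f\<close> takes values in \<open>span C'\<close>, the vectors of \<open>E - C'\<close>
  contribute zero diagonal entries.\<close>

lemma tr_on_image:
  assumes C: "independent C" "independent C'"
    and f: "endo f" and sub: "span C' \<subseteq> span C" and inv: "\<And>v. v \<in> span C \<Longrightarrow> f v \<in> span C'"
  shows "tr_on C f = tr_on C' f"
proof -
  obtain E where E: "C' \<subseteq> E" "E \<subseteq> span C" "independent E" "span C \<subseteq> span E"
    using maximal_independent_subset_extend[OF order_trans[OF span_superset sub] C(2)] by metis
  have sp: "span E = span C" using E span_minimal[OF E(2) subspace_span] by auto
  have fin: "finite E" using E finiteI_independent by auto
  have "tr_on C f = tr_on E f"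
    using tr_on_eq_if_span_eq[OF C(1) E(3) sp f] inv sub by blast
  also have "\<dots> = (\<Sum>c\<in>E. representation C' (f c) c)"
    unfolding tr_on_def
    using representation_extend[OF E(3) _ E(1)] inv sp span_base by (metis (no_types, lifting) sum.cong)
  also have "\<dots> = tr_on C' f"
    unfolding tr_on_def using E(1) fin representation_ne_zero
    by (intro sum.mono_neutral_right) auto
  finally show ?thesis .
qed

lemma subspace_image_endo: "endo f \<Longrightarrow> subspace S \<Longrightarrow> subspace (f ` S)"
  by (rule module_hom.subspace_image)

text \<open>The trace may be computed on the range, where \<open>f\<close> is the identity.\<close>

lemma tr_idempotent:
  assumes f: "endo f" and idem: "\<And>v. f (f v) = f v"
  shows "tr f = of_nat (dim (range f))"
proof -
  have s: "subspace (range f)" using subspace_image_endo[OF f subspace_UNIV] .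
  obtain C where C: "C \<subseteq> range f" "independent C" "range f \<subseteq> span C" "card C = dim (range f)"
    using basis_exists by blast
  have sp: "span C = range f" using C span_minimal[OF C(1) s] by auto
  have "tr f = tr_on C f"
    by (rule tr_on_image[OF independent_Basis C(2) f]) (auto simp: sp span_Basis)
  also have "\<dots> = (\<Sum>c\<in>C. 1)"
    unfolding tr_on_def
  proof (rule sum.cong)
    fix c assume "c \<in> C"
    moreover then have "f c = c" using C(1) idem by auto
    ultimately show "representation C (f c) c = 1"
      using representation_basis[OF C(2)] by simp
  qed simp
  finally show ?thesis using C by simp
qed

text \<open>Restricting from the range of one power to the range of the next keeps the trace, and
  the last range is zero.\<close>

lemma tr_nilpotent:
  assumes f: "endo f" and nil: "\<And>v. (f ^^ M) v = 0"
  shows "tr f = 0"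
proof -
  have main: "\<exists>C. independent C \<and> span C = range (f ^^ i) \<and> tr f = tr_on C f" for i
  proof (induction i)
    case 0
    show ?case using independent_Basis span_Basis by auto
  next
    case (Suc i)
    then obtain C where C: "independent C" "span C = range (f ^^ i)" "tr f = tr_on C f" by blast
    have s: "subspace (range (f ^^ Suc i))"
      using subspace_image_endo[OF endo_funpow[OF f] subspace_UNIV] .
    obtain E where E: "E \<subseteq> range (f ^^ Suc i)" "independent E" "range (f ^^ Suc i) \<subseteq> span E"
      using basis_exists[of "range (f ^^ Suc i)"] by metis
    have sp: "span E = range (f ^^ Suc i)" using E span_minimal[OF E(1) s] by auto
    have "tr_on C f = tr_on E f"
    proof (rule tr_on_image[OF C(1) E(2) f])
      show "span E \<subseteq> span C"
        unfolding sp C(2) by (auto simp: funpow_swap1)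
      show "f v \<in> span E" if "v \<in> span C" for v
        using that unfolding sp C(2) by auto
    qed
    then show ?case using C E sp by metis
  qed
  obtain C where C: "independent C" "span C = range (f ^^ M)" "tr f = tr_on C f"
    using main by blast
  have "C \<subseteq> {0}" using C(2) span_superset[of C] nil by auto
  moreover have "0 \<notin> C" using C(1) dependent_zero by blast
  ultimately have "C = {}" by auto
  then show ?thesis using C by (simp add: tr_on_def)
qed

lemma tr_add: "tr (\<lambda>v. f v + h v) = tr f + tr h"
  by (simp add: tr_on_def representation_add independent_Basis span_Basis sum.distrib)

lemma tr_diff: "tr (\<lambda>v. f v - h v) = tr f - tr h"
  by (simp add: tr_on_def representation_diff independent_Basis span_Basis sum_subtractf)

lemma tr_scale: "tr (\<lambda>v. c *\<^sub>C f v) = c * tr f"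
  by (simp add: tr_on_def representation_scale independent_Basis span_Basis sum_distrib_left)

lemma tr_zero: "tr (\<lambda>v. 0) = 0"
  by (simp add: tr_on_def representation_zero)

lemma tr_sum: "finite A \<Longrightarrow> tr (\<lambda>v. \<Sum>a\<in>A. f a v) = (\<Sum>a\<in>A. tr (f a))"
  by (induction A rule: finite_induct) (simp_all add: tr_zero tr_add)

lemma tr_commute:
  assumes f: "endo f" and h: "endo h"
  shows "tr (\<lambda>v. f (h v)) = tr (\<lambda>v. h (f v))"
proof -
  have exp: "representation Basis (f (h b)) b = (\<Sum>c\<in>Basis. representation Basis (h b) c * representation Basis (f c) b)"
    if f: "endo f" for f h b
  proof -
    have "f (h b) = f (\<Sum>c\<in>Basis. representation Basis (h b) c *\<^sub>C c)"
      using sum_representation_eq[OF independent_Basis _ finite_Basis] by (simp add: span_Basis)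
    also have "\<dots> = (\<Sum>c\<in>Basis. representation Basis (h b) c *\<^sub>C f c)"
      by (simp add: module_hom.sum[OF f] module_hom.scale[OF f])
    finally show ?thesis
      by (simp add: representation_combination[OF independent_Basis] span_Basis)
  qed
  show ?thesis
    unfolding tr_on_def exp[OF f, of h] exp[OF h, of f]
    by (subst sum.swap) (simp add: mult.commute)
qed

end

section \<open>Polynomials in an endomorphism\<close>

locale complex_endo = complex_fdvs scale Basis
  for scale :: "complex \<Rightarrow> 'b::ab_group_add \<Rightarrow> 'b" (infixr \<open>*\<^sub>C\<close> 75) and Basis +
  fixes D :: "'b \<Rightarrow> 'b"
  assumes endo_D: "module_hom scale scale D"
begin

definition ev :: "complex poly \<Rightarrow> 'b \<Rightarrow> 'b" where
  "ev p v = (\<Sum>i\<le>degree p. coeff p i *\<^sub>C (D ^^ i) v)"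

lemma ev_bound: "degree p \<le> N \<Longrightarrow> ev p v = (\<Sum>i\<le>N. coeff p i *\<^sub>C (D ^^ i) v)"
  unfolding ev_def by (rule sum.mono_neutral_left) (auto simp: coeff_eq_0)

lemma D_zero [simp]: "D 0 = 0"
  using module_hom.zero[OF endo_D] .

lemma ev_0 [simp]: "ev 0 v = 0"
  by (simp add: ev_def)

lemma ev_pCons [simp]: "ev (pCons a p) v = a *\<^sub>C v + D (ev p v)"
proof -
  have "ev (pCons a p) v = (\<Sum>i\<le>Suc (degree p). coeff (pCons a p) i *\<^sub>C (D ^^ i) v)"
    by (rule ev_bound) (simp add: degree_pCons_le)
  also have "\<dots> = a *\<^sub>C v + D (ev p v)"
    by (subst sum.atMost_Suc_shift)
       (simp add: ev_def module_hom.sum[OF endo_D] module_hom.scale[OF endo_D])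
  finally show ?thesis .
qed

lemma ev_1 [simp]: "ev 1 v = v"
  by (simp add: one_pCons)

lemma ev_add: "ev (p + q) v = ev p v + ev q v"
  by (induction p q rule: poly_induct2)
     (simp_all add: scale_left_distrib module_hom.add[OF endo_D])

lemma ev_smult: "ev (smult c p) v = c *\<^sub>C ev p v"
  by (induction p) (simp_all add: scale_right_distrib module_hom.scale[OF endo_D])

lemma ev_mult: "ev (p * q) v = ev p (ev q v)"
  by (induction p) (simp_all add: ev_add ev_smult)

lemma ev_uminus: "ev (- p) v = - ev p v"
  using ev_smult[of "-1" p v] by simp

lemma ev_diff: "ev (p - q) v = ev p v - ev q v"
  using ev_add[of p "- q" v] by (simp add: ev_uminus)

lemma ev_sum: "finite A \<Longrightarrow> ev (sum p A) v = (\<Sum>a\<in>A. ev (p a) v)"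
  by (induction A rule: finite_induct) (simp_all add: ev_add)

lemma ev_monom: "ev (monom c i) v = c *\<^sub>C (D ^^ i) v"
  by (induction i) (simp_all add: monom_0 monom_Suc module_hom.scale[OF endo_D])

lemma ev_power: "ev (p ^ i) v = (ev p ^^ i) v"
  by (induction i) (simp_all add: ev_mult)

lemma endo_ev: "endo (ev p)"
proof (rule endoI)
  show "ev p (x + y) = ev p x + ev p y" for x y
    by (induction p) (simp_all add: scale_right_distrib module_hom.add[OF endo_D])
  show "ev p (c *\<^sub>C x) = c *\<^sub>C ev p x" for c x
    by (induction p) (simp_all add: scale_right_distrib module_hom.scale[OF endo_D] mult.commute)
qed

lemma ev_dvd_0:
  assumes "p dvd q" "ev p v = 0" shows "ev q v = 0"
  using assms module_hom.zero[OF endo_ev] by (auto simp: dvd_def ev_mult mult.commute[of p])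

lemma ev_subspace:
  assumes "subspace S" "\<And>v. v \<in> S \<Longrightarrow> D v \<in> S" "v \<in> S"
  shows "ev p v \<in> S"
  by (induction p) (simp_all add: assms subspace_0 subspace_add subspace_scale)

text \<open>One more iterate of \<open>v\<close> than the dimension forces a linear relation, whose
  coefficients form the polynomial.\<close>

lemma annihilating_poly_at: "\<exists>p. p \<noteq> 0 \<and> ev p v = 0"
proof -
  let ?N = "card Basis" let ?d = "\<lambda>i. (D ^^ i) v"
  show ?thesis
  \<comment> \<open>Dependence is a property of the set of iterates, which forgets repetitions, so
    two equal iterates are treated separately.\<close>
  proof (cases "inj_on ?d {..?N}")
    case False
    then obtain i j where ij: "i \<noteq> j" "?d i = ?d j" by (auto simp: inj_on_def)
    have "monom 1 i - monom 1 j \<noteq> (0 :: complex poly)"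
      using ij by (simp add: monom_eq_iff')
    moreover have "ev (monom 1 i - monom 1 j) v = 0"
      using ij by (simp add: ev_diff ev_monom)
    ultimately show ?thesis by blast
  next
    case True
    have "dim (?d ` {..?N}) < card (?d ` {..?N})"
      using dim_subset_UNIV[of "?d ` {..?N}"] by (simp add: card_image[OF True] dimension_def)
    then have "dependent (?d ` {..?N})"
      using dependent_biggerset_general by blast
    then obtain u w where u: "(\<Sum>x\<in>?d ` {..?N}. u x *\<^sub>C x) = 0" "w \<in> ?d ` {..?N}" "u w \<noteq> 0"
      by (auto simp: dependent_finite)
    obtain j where j: "j \<le> ?N" "w = ?d j" using u(2) by auto
    define p where "p = (\<Sum>i\<le>?N. monom (u (?d i)) i)"
    have "coeff p j = u w"
      unfolding p_def using j by (simp add: coeff_sum if_distrib cong: if_cong)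
    then have "p \<noteq> 0" using u(3) by auto
    moreover have "ev p v = 0"
      using u(1) by (simp add: p_def ev_sum ev_monom sum.reindex[OF True])
    ultimately show ?thesis by blast
  qed
qed

text \<open>The product of the polynomials that annihilate the basis vectors annihilates
  everything.\<close>

lemma annihilating_poly: "\<exists>p. p \<noteq> 0 \<and> (\<forall>v. ev p v = 0)"
proof -
  obtain P where P: "\<And>v. P v \<noteq> 0" "\<And>v. ev (P v) v = 0"
    using annihilating_poly_at by metis
  let ?p = "\<Prod>b\<in>Basis. P b"
  have "?p \<noteq> 0" using P finite_Basis by simp
  moreover have "ev ?p v = 0" for v
  proof -
    have "v \<in> span Basis" by (simp add: span_Basis)
    then show ?thesis
    proof (induction rule: span_induct_alt)
      case base
      show ?case using module_hom.zero[OF endo_ev] .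
    next
      case (step c x y)
      have "ev ?p x = 0"
        using ev_dvd_0[OF _ P(2)] dvd_prodI[OF finite_Basis step(1)] by blast
      then show ?case using step
        by (simp add: module_hom.add[OF endo_ev] module_hom.scale[OF endo_ev])
    qed
  qed
  ultimately show ?thesis by blast
qed

end

section \<open>Simultaneous congruences for polynomials\<close>

text \<open>Roots are split off one at a time. A single exponent for all roots replaces the
  multiplicities; it grows by one with each root split off, which is enough for
  divisibility.\<close>

lemma dvd_power_of_linear_factors:
  fixes p :: "complex poly"
  assumes "p \<noteq> 0"
  shows "\<exists>\<Lambda> M. finite \<Lambda> \<and> p dvd (\<Prod>a\<in>\<Lambda>. [:- a, 1:] ^ M)"
  using assms
proof (induction "degree p" arbitrary: p rule: less_induct)
  case less
  show ?case
  proof (cases "degree p = 0")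
    case True
    then show ?thesis using less.prems
      by (intro exI[of _ "{}"]) (auto simp: is_unit_iff_degree)
  next
    case False
    then obtain a where "poly p a = 0"
      using fundamental_theorem_of_algebra[of p] constant_degree[of p] by metis
    then obtain r where r: "p = [:- a, 1:] * r"
      by (metis dvdE poly_eq_0_iff_dvd)
    have "r \<noteq> 0" using r less.prems by auto
    then have "degree r < degree p" unfolding r by (simp add: degree_mult_eq del: mult_pCons_left)
    then obtain \<Lambda> M where L: "finite \<Lambda>" "r dvd (\<Prod>a\<in>\<Lambda>. [:- a, 1:] ^ M)"
      using less.hyps \<open>r \<noteq> 0\<close> by blast
    have "(\<Prod>a\<in>\<Lambda>. [:- a, 1:] ^ M) dvd (\<Prod>b\<in>insert a \<Lambda>. [:- b, 1:] ^ M)"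
      by (rule prod_dvd_prod_subset) (use L in auto)
    moreover have "[:- a, 1:] dvd (\<Prod>b\<in>insert a \<Lambda>. [:- b, 1:])"
      using L by (intro dvd_prodI) auto
    ultimately have "p dvd (\<Prod>b\<in>insert a \<Lambda>. [:- b, 1:]) * (\<Prod>b\<in>insert a \<Lambda>. [:- b, 1:] ^ M)"
      unfolding r using L(2) by (intro mult_dvd_mono) (auto intro: dvd_trans)
    also have "\<dots> = (\<Prod>b\<in>insert a \<Lambda>. [:- b, 1:] ^ Suc M)"
      by (simp only: power_Suc prod.distrib)
    finally show ?thesis using L(1) by blast
  qed
qed

lemma coprime_linear_factors:
  fixes a b :: complex
  assumes "a \<noteq> b" shows "coprime ([:- a, 1:] ^ i) ([:- b, 1:] ^ j)"
proof -
  have "coprime [:- a, 1:] [:- b, 1:]"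
  proof (rule coprimeI)
    fix c assume c: "c dvd [:- a, 1:]" "c dvd [:- b, 1:]"
    have "c dvd [:- a, 1:] - [:- b, 1:]" using c by (rule dvd_diff)
    also have "\<dots> = [:b - a:]" by simp
    also have "\<dots> dvd 1" using assms by (simp add: is_unit_const_poly_iff dvd_field_iff)
    finally show "is_unit c" .
  qed
  then show ?thesis by simp
qed

lemma prod_powers_dvd:
  fixes p :: "complex poly"
  assumes "finite \<Lambda>" "\<And>a. a \<in> \<Lambda> \<Longrightarrow> [:- a, 1:] ^ M dvd p"
  shows "(\<Prod>a\<in>\<Lambda>. [:- a, 1:] ^ M) dvd p"
  using assms
proof (induction \<Lambda> rule: finite_induct)
  case (insert a \<Lambda>)
  have "coprime ([:- a, 1:] ^ M) (\<Prod>a\<in>\<Lambda>. [:- a, 1:] ^ M)"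
    using insert.hyps by (intro prod_coprime_right coprime_linear_factors) auto
  then show ?case using insert by (simp add: divides_mult)
qed simp

lemma poly_chinese_remainder:
  fixes c :: "complex \<Rightarrow> complex"
  assumes "finite \<Lambda>"
  shows "\<exists>q. \<forall>a\<in>\<Lambda>. [:- a, 1:] ^ M dvd q - [:c a:]"
  using assms
proof (induction \<Lambda> rule: finite_induct)
  case (insert b \<Lambda>)
  then obtain q where q: "\<And>a. a \<in> \<Lambda> \<Longrightarrow> [:- a, 1:] ^ M dvd q - [:c a:]" by blast
  define P where "P = (\<Prod>a\<in>\<Lambda>. [:- a, 1:] ^ M)"
  have "coprime P ([:- b, 1:] ^ M)"
    unfolding P_def using insert.hyps by (intro prod_coprime_left coprime_linear_factors) auto
  then obtain x y where xy: "x * P + y * [:- b, 1:] ^ M = 1"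
    using bezout_coefficients_fst_snd[of P "[:- b, 1:] ^ M"] by (metis coprime_imp_gcd_eq_1)
  \<comment> \<open>The correction is a multiple of \<open>P\<close>, so the old congruences
    survive; modulo the new power \<open>x * P\<close> is 1, so \<open>q'\<close> becomes the
    constant \<open>c b\<close>.\<close>
  define q' where "q' = q + P * (x * ([:c b:] - q))"
  have "[:- a, 1:] ^ M dvd q' - [:c a:]" if "a \<in> \<Lambda>" for a
  proof -
    have "[:- a, 1:] ^ M dvd P"
      unfolding P_def by (rule dvd_prodI[OF insert.hyps(1) that])
    moreover have "q' - [:c a:] = (q - [:c a:]) + P * (x * ([:c b:] - q))"
      by (simp add: q'_def)
    ultimately show ?thesis using q[OF that] by (metis dvd_add dvd_mult2)
  qed
  moreover have "[:- b, 1:] ^ M dvd q' - [:c b:]"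
  proof -
    have "q' - [:c b:] = (x * P + y * [:- b, 1:] ^ M - 1) * ([:c b:] - q)
        + [:- b, 1:] ^ M * (y * (q - [:c b:]))"
      unfolding q'_def by (simp only: algebra_simps mult_1_left)
    then show ?thesis unfolding xy by simp
  qed
  ultimately show ?case by auto
qed simp

lemma poly_eq_if_power_dvd:
  fixes p :: "complex poly"
  assumes "[:- a, 1:] ^ Suc i dvd p - [:c:]"
  shows "poly p a = c"
proof -
  have "[:- a, 1:] dvd p - [:c:]" using assms by (metis dvd_mult_left power_Suc)
  then show ?thesis by (simp add: poly_eq_0_iff_dvd[symmetric])
qed

lemma power_dvd_le:
  fixes p r :: "'c::comm_semiring_1"
  assumes "p ^ j dvd r" "i \<le> j" shows "p ^ i dvd r"
  using assms le_imp_power_dvd dvd_trans by blast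

section \<open>Spectral projections as polynomials in the endomorphism\<close>

text \<open>The set \<open>\<Lambda>\<close> contains all eigenvalues but may be larger; at a point
  that is not an eigenvalue the generalized eigenspace is zero.\<close>

locale annihilated_endo = complex_endo scale Basis D
  for scale :: "complex \<Rightarrow> 'b::ab_group_add \<Rightarrow> 'b" (infixr \<open>*\<^sub>C\<close> 75) and Basis D +
  fixes \<Lambda> :: "complex set" and M :: nat
  assumes finite_spectrum: "finite \<Lambda>"
    and annihilated: "ev (\<Prod>a\<in>\<Lambda>. [:- a, 1:] ^ M) v = 0"
begin

lemma ev_0I: "(\<And>a. a \<in> \<Lambda> \<Longrightarrow> [:- a, 1:] ^ M dvd p) \<Longrightarrow> ev p v = 0"
  using ev_dvd_0[OF prod_powers_dvd annihilated] finite_spectrum by blast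

lemma ev_cong: "(\<And>a. a \<in> \<Lambda> \<Longrightarrow> [:- a, 1:] ^ M dvd p - r) \<Longrightarrow> ev p v = ev r v"
  using ev_0I[of "p - r" v] by (simp add: ev_diff)

text \<open>For \<open>b\<close> in \<open>\<Lambda>\<close>, evaluating this polynomial at
  \<open>D\<close> gives the projection onto the generalized eigenspace of \<open>b\<close>. The
  exponent \<open>Suc M\<close> fixes the values on \<open>\<Lambda>\<close> even when
  \<open>M\<close> is 0.\<close>

definition eproj :: "complex \<Rightarrow> complex poly" where
  "eproj b = (SOME e. \<forall>a\<in>\<Lambda>. [:- a, 1:] ^ Suc M dvd e - [:if a = b then 1 else 0:])"

lemma eproj: "a \<in> \<Lambda> \<Longrightarrow> [:- a, 1:] ^ Suc M dvd eproj b - [:if a = b then 1 else 0:]"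
  using someI_ex[OF poly_chinese_remainder[OF finite_spectrum, of "Suc M" "\<lambda>a. if a = b then 1 else 0"]]
  unfolding eproj_def by blast

lemma eproj_eq: "a \<in> \<Lambda> \<Longrightarrow> [:- a, 1:] ^ M dvd eproj a - 1"
  using power_dvd_le[OF eproj[of a a]] by (simp add: one_pCons)

lemma eproj_neq: "a \<in> \<Lambda> \<Longrightarrow> a \<noteq> b \<Longrightarrow> [:- a, 1:] ^ M dvd eproj b"
  using power_dvd_le[OF eproj[of a b]] by simp

lemma poly_eproj: "a \<in> \<Lambda> \<Longrightarrow> poly (eproj b) a = (if a = b then 1 else 0)"
  using poly_eq_if_power_dvd[OF eproj] by blast

lemma sum_eproj: "(\<Sum>b\<in>\<Lambda>. ev (eproj b) v) = v"
proof -
  have "ev (\<Sum>b\<in>\<Lambda>. eproj b) v = ev 1 v"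
  proof (rule ev_cong)
    fix a assume a: "a \<in> \<Lambda>"
    have "(\<Sum>b\<in>\<Lambda>. eproj b) - 1 = (eproj a - 1) + (\<Sum>b\<in>\<Lambda> - {a}. eproj b)"
      using sum.remove[OF finite_spectrum a, of eproj] by simp
    moreover have "[:- a, 1:] ^ M dvd (\<Sum>b\<in>\<Lambda> - {a}. eproj b)"
      using eproj_neq[OF a] by (intro dvd_sum) auto
    ultimately show "[:- a, 1:] ^ M dvd (\<Sum>b\<in>\<Lambda>. eproj b) - 1"
      using eproj_eq[OF a] by (metis dvd_add)
  qed
  then show ?thesis by (simp add: ev_sum finite_spectrum)
qed

lemma eproj_generalized_eigenvector:
  assumes "b \<in> \<Lambda>"
  shows "ev ([:- b, 1:] ^ M) (ev (eproj b) v) = 0"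
  unfolding ev_mult[symmetric] using eproj_neq by (intro ev_0I) (metis dvd_mult dvd_triv_left)

lemma eproj_idem: "ev (eproj b) (ev (eproj b) v) = ev (eproj b) v"
proof -
  have "ev (eproj b * eproj b) v = ev (eproj b) v"
  proof (rule ev_cong)
    fix a assume a: "a \<in> \<Lambda>"
    have "eproj b * eproj b - eproj b = eproj b * (eproj b - 1)"
      by (simp add: algebra_simps)
    then show "[:- a, 1:] ^ M dvd eproj b * eproj b - eproj b"
      using eproj_eq[OF a] eproj_neq[OF a, of b] by (cases "a = b") (simp_all add: dvd_mult dvd_mult2)
  qed
  then show ?thesis by (simp add: ev_mult)
qed

text \<open>Up to a nilpotent remainder, \<open>D\<close> times \<open>q\<close> evaluated at
  \<open>D\<close> is the sum of the spectral projections weighted by the squared moduli of the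
  eigenvalues. Its trace is a sum of nonnegative terms, so only the eigenvalue 0 can have a nonzero
  projection.\<close>

lemma nilpotent_if_tr_conj_eq_0:
  assumes q: "\<And>a. a \<in> \<Lambda> \<Longrightarrow> poly q a = cnj a"
    and tr0: "tr (\<lambda>v. D (ev q v)) = 0"
  shows "(D ^^ M) v = 0"
proof -
  \<comment> \<open>This remainder has a root at every point of \<open>\<Lambda>\<close>, so its
    \<open>M\<close>-th power annihilates the space and its trace is zero.\<close>
  define r where "r = [:0, 1:] * q - (\<Sum>b\<in>\<Lambda>. smult (b * cnj b) (eproj b))"
  have "[:- a, 1:] dvd r" if "a \<in> \<Lambda>" for a
  proof -
    have "(\<Sum>b\<in>\<Lambda>. b * cnj b * poly (eproj b) a) = (\<Sum>b\<in>\<Lambda>. if a = b then b * cnj b else 0)"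
      using poly_eproj[OF that] by (intro sum.cong) auto
    then have "poly r a = 0"
      using that finite_spectrum by (simp add: r_def q poly_sum)
    then show ?thesis by (simp add: poly_eq_0_iff_dvd)
  qed
  then have "ev (r ^ M) v = 0" for v
    by (intro ev_0I dvd_power_same)
  then have tr_r: "tr (ev r) = 0"
    using tr_nilpotent[OF endo_ev, of M r] by (simp add: ev_power)
  have "D (ev q v) = (\<Sum>b\<in>\<Lambda>. (b * cnj b) *\<^sub>C ev (eproj b) v) + ev r v" for v
    by (simp add: r_def ev_diff ev_sum finite_spectrum ev_smult)
  then have "tr (\<lambda>v. D (ev q v)) = (\<Sum>b\<in>\<Lambda>. (b * cnj b) * tr (ev (eproj b)))"
    by (simp add: tr_add tr_sum finite_spectrum tr_scale tr_r)
  also have "\<dots> = (\<Sum>b\<in>\<Lambda>. of_real ((cmod b)\<^sup>2 * real (dim (range (ev (eproj b))))))"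
    by (simp add: tr_idempotent[OF endo_ev eproj_idem] complex_norm_square[symmetric])
  finally have "(\<Sum>b\<in>\<Lambda>. (cmod b)\<^sup>2 * real (dim (range (ev (eproj b))))) = 0"
    unfolding tr0 of_real_sum[symmetric] by (metis of_real_eq_0_iff)
  then have "\<forall>b\<in>\<Lambda>. (cmod b)\<^sup>2 * real (dim (range (ev (eproj b)))) = 0"
    by (subst (asm) sum_nonneg_eq_0_iff) (auto simp: finite_spectrum)
  then have 0: "ev (eproj b) w = 0" if "b \<in> \<Lambda>" "b \<noteq> 0" for b w
    using that by auto
  \<comment> \<open>\<open>D ^^ M\<close> kills the component at 0, a generalized eigenvector; all
    other components already vanish.\<close>
  have "ev (monom 1 M) (ev (eproj b) v) = 0" if "b \<in> \<Lambda>" for b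
  proof (cases "b = 0")
    case True
    then show ?thesis using eproj_generalized_eigenvector[OF that] by (simp add: monom_altdef)
  next
    case False
    then show ?thesis using 0[OF that] module_hom.zero[OF endo_ev] by simp
  qed
  then have "ev (monom 1 M) (\<Sum>b\<in>\<Lambda>. ev (eproj b) v) = 0"
    by (simp add: module_hom.sum[OF endo_ev])
  then show ?thesis by (simp add: sum_eproj ev_monom)
qed

end

section \<open>The conjugate of the semisimple part of a derivation\<close>

text \<open>The Jacobi identity enters in the form that every left multiplication is a
  derivation.\<close>

locale leibniz_algebra = complex_fdvs scale Basis
  for scale :: "complex \<Rightarrow> 'b::ab_group_add \<Rightarrow> 'b" (infixr \<open>*\<^sub>C\<close> 75) and Basis +
  fixes B :: "'b \<Rightarrow> 'b \<Rightarrow> 'b"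
  assumes endo_left: "module_hom scale scale (\<lambda>u. B u v)"
    and endo_right: "module_hom scale scale (\<lambda>v. B u v)"
    and leibniz: "B x (B u v) = B (B x u) v + B u (B x v)"
begin

lemmas B_add = module_hom.add[OF endo_left] module_hom.add[OF endo_right]
lemmas B_scale = module_hom.scale[OF endo_left] module_hom.scale[OF endo_right]
lemmas B_zero = module_hom.zero[OF endo_left] module_hom.zero[OF endo_right]
lemmas B_diff = module_hom.diff[OF endo_left] module_hom.diff[OF endo_right]
lemmas B_sum = module_hom.sum[OF endo_left] module_hom.sum[OF endo_right]

text \<open>By the Leibniz rule \<open>B x\<close> minus \<open>a + b\<close> acts on a product as
  \<open>B x\<close> minus \<open>a\<close> on the first factor plus \<open>B x\<close> minus
  \<open>b\<close> on the second. Induction on \<open>i + j\<close> replaces the binomial expansion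
  of the power.\<close>

lemma generalized_eigenvectors_B:
  assumes "complex_endo.ev scale (B x) ([:- a, 1:] ^ i) u = 0"
    and "complex_endo.ev scale (B x) ([:- b, 1:] ^ j) v = 0"
  shows "complex_endo.ev scale (B x) ([:- (a + b), 1:] ^ (i + j)) (B u v) = 0"
proof -
  interpret complex_endo scale Basis "B x" by (intro complex_endo.intro complex_endo_axioms.intro complex_fdvs_axioms endo_right)
  have step: "ev [:- (a + b), 1:] (B u v) = B (ev [:- a, 1:] u) v + B u (ev [:- b, 1:] v)" for u v
    by (simp add: leibniz[of x u v] B_add B_scale B_diff scale_left_distrib algebra_simps)
  have *: "ev (p ^ Suc n) w = ev (p ^ n) (ev p w)" for p n w
    unfolding power_Suc2 by (rule ev_mult)
  show ?thesis
    using assms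
  proof (induction "i + j" arbitrary: i j u v rule: less_induct)
    case less
    show ?case
    proof (cases "i = 0 \<or> j = 0")
      case True
      then have "B u v = 0" using less.prems by (auto simp: B_zero)
      then show ?thesis using module_hom.zero[OF endo_ev] by simp
    next
      case False
      then obtain i' j' where ij: "i = Suc i'" "j = Suc j'" using not0_implies_Suc by blast
      have "ev ([:- (a + b), 1:] ^ (i' + j)) (B (ev [:- a, 1:] u) v) = 0"
        using less.hyps[of i' j] less.prems unfolding ij * by simp
      moreover have "ev ([:- (a + b), 1:] ^ (i + j')) (B u (ev [:- b, 1:] v)) = 0"
        using less.hyps[of i j'] less.prems unfolding ij(2) * by simp
      ultimately have "ev ([:- (a + b), 1:] ^ Suc (i + j')) (B u v) = 0"
        unfolding * step module_hom.add[OF endo_ev] by (simp add: ij)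
      then show ?thesis by (simp add: ij)
    qed
  qed
qed

text \<open>Complex conjugation is additive, so acting by the conjugate eigenvalue on each generalized
  eigenspace of the derivation \<^term>\<open>B x\<close> is again a derivation.\<close>

lemma conjugate_derivation:
  "\<exists>\<Lambda> M q. annihilated_endo scale Basis (B x) \<Lambda> M \<and> (\<forall>a\<in>\<Lambda>. poly q a = cnj a) \<and>
     (\<forall>u v. complex_endo.ev scale (B x) q (B u v)
       = B (complex_endo.ev scale (B x) q u) v + B u (complex_endo.ev scale (B x) q v))"
proof -
  interpret complex_endo scale Basis "B x" by (intro complex_endo.intro complex_endo_axioms.intro complex_fdvs_axioms endo_right)
  obtain p where p: "p \<noteq> 0" "\<And>v. ev p v = 0" using annihilating_poly by blast
  obtain \<Lambda> M where L: "finite \<Lambda>" "p dvd (\<Prod>a\<in>\<Lambda>. [:- a, 1:] ^ M)"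
    using dvd_power_of_linear_factors[OF p(1)] by blast
  interpret annihilated_endo scale Basis "B x" \<Lambda> M
    by unfold_locales (use L ev_dvd_0[OF L(2) p(2)] in auto)
  \<comment> \<open>A product of generalized eigenvectors for \<open>a\<close> and \<open>b\<close>
    belongs to \<open>a + b\<close> with exponent \<open>M + M\<close>, so \<open>q\<close> has to
    be prescribed at the sums too and to that order.\<close>
  let ?\<Lambda>' = "\<Lambda> \<union> (\<lambda>(a, b). a + b) ` (\<Lambda> \<times> \<Lambda>)"
  obtain q where q: "\<And>a. a \<in> ?\<Lambda>' \<Longrightarrow> [:- a, 1:] ^ Suc (M + M) dvd q - [:cnj a:]"
    using poly_chinese_remainder[of ?\<Lambda>' "Suc (M + M)" cnj] L by auto
  have eig: "ev q w = cnj a *\<^sub>C w"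
    if "a \<in> ?\<Lambda>'" "ev ([:- a, 1:] ^ i) w = 0" "i \<le> M + M" for a w i
  proof -
    have "ev (q - [:cnj a:]) w = 0"
      by (rule ev_dvd_0[OF power_dvd_le[OF q[OF that(1)]] that(2)]) (use that in simp)
    then show ?thesis by (simp add: ev_diff)
  qed
  have der: "ev q (B u v) = B (ev q u) v + B u (ev q v)"
    if "a \<in> \<Lambda>" "b \<in> \<Lambda>" "ev ([:- a, 1:] ^ M) u = 0" "ev ([:- b, 1:] ^ M) v = 0" for a b u v
  proof -
    have "ev q (B u v) = cnj (a + b) *\<^sub>C B u v"
      by (rule eig[OF _ generalized_eigenvectors_B[OF that(3,4)]]) (use that in auto)
    moreover have "ev q u = cnj a *\<^sub>C u" "ev q v = cnj b *\<^sub>C v"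
      using eig[OF _ that(3)] eig[OF _ that(4)] that by auto
    ultimately show ?thesis by (simp add: B_scale scale_left_distrib)
  qed
  have "ev q (B u v) = B (ev q u) v + B u (ev q v)" for u v
  proof -
    let ?u = "\<lambda>a. ev (eproj a) u" let ?v = "\<lambda>b. ev (eproj b) v"
    have "ev q (B (\<Sum>a\<in>\<Lambda>. ?u a) (\<Sum>b\<in>\<Lambda>. ?v b)) = (\<Sum>b\<in>\<Lambda>. \<Sum>a\<in>\<Lambda>. ev q (B (?u a) (?v b)))"
      by (simp add: B_sum module_hom.sum[OF endo_ev])
    also have "\<dots> = (\<Sum>b\<in>\<Lambda>. \<Sum>a\<in>\<Lambda>. B (ev q (?u a)) (?v b) + B (?u a) (ev q (?v b)))"
      using der eproj_generalized_eigenvector by (intro sum.cong) auto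
    also have "\<dots> = B (ev q (\<Sum>a\<in>\<Lambda>. ?u a)) (\<Sum>b\<in>\<Lambda>. ?v b) + B (\<Sum>a\<in>\<Lambda>. ?u a) (ev q (\<Sum>b\<in>\<Lambda>. ?v b))"
      by (simp add: B_sum module_hom.sum[OF endo_ev] sum.distrib)
    finally show ?thesis by (simp only: sum_eproj)
  qed
  moreover have "poly q a = cnj a" if "a \<in> \<Lambda>" for a
    using poly_eq_if_power_dvd[OF q] that by blast
  ultimately show ?thesis using annihilated_endo_axioms by blast
qed

text \<open>Let Q be the derivation \<open>ev q\<close> with conjugate eigenvalues. Since the
  commutator of Q with left multiplication by \<open>b\<close> is left multiplication by
  Q\<open>b\<close>, cyclicity of the trace reduces the pairing of Q with a bracket of
  \<open>a\<close> and \<open>b\<close> to the trace form of \<open>a\<close> and Q\<open>b\<close>,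
  which vanishes on \<open>S\<close>.\<close>

lemma cartan_nilpotency:
  assumes S: "subspace S" "\<And>u v. u \<in> S \<Longrightarrow> v \<in> S \<Longrightarrow> B u v \<in> S"
    and tr0: "\<And>u v. u \<in> S \<Longrightarrow> v \<in> S \<Longrightarrow> tr (\<lambda>w. B u (B v w)) = 0"
    and x: "x \<in> span {B u v | u v. u \<in> S \<and> v \<in> S}"
  shows "\<exists>M. \<forall>v. (B x ^^ M) v = 0"
proof -
  obtain \<Lambda> M q where q: "annihilated_endo scale Basis (B x) \<Lambda> M"
    "\<And>a. a \<in> \<Lambda> \<Longrightarrow> poly q a = cnj a"
    "\<And>u v. complex_endo.ev scale (B x) q (B u v)
       = B (complex_endo.ev scale (B x) q u) v + B u (complex_endo.ev scale (B x) q v)"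
    using conjugate_derivation[of x] by blast
  interpret annihilated_endo scale Basis "B x" \<Lambda> M by fact
  have "{B u v | u v. u \<in> S \<and> v \<in> S} \<subseteq> S" using S by auto
  then have xS: "x \<in> S" using x span_minimal S(1) by blast
  have zero: "tr (\<lambda>w. B (B a b) (ev q w)) = 0" if "a \<in> S" "b \<in> S" for a b
  proof -
    \<comment> \<open>Here it matters that \<open>ev q\<close> is a polynomial in \<open>B x\<close>
      with \<open>x\<close> in \<open>S\<close>.\<close>
    have Qb: "ev q b \<in> S" using ev_subspace[OF S(1)] S(2) xS that by blast
    have "B (B a b) (ev q w) = B a (B b (ev q w)) - B b (B a (ev q w))" for w
      using leibniz[of a b "ev q w"] by simp
    then have "tr (\<lambda>w. B (B a b) (ev q w)) = tr (\<lambda>w. B a (B b (ev q w))) - tr (\<lambda>w. B b (B a (ev q w)))"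
      by (simp add: tr_diff)
    also have "tr (\<lambda>w. B b (B a (ev q w))) = tr (\<lambda>w. B a (ev q (B b w)))"
      by (rule tr_commute[OF endo_right[of b] endo_compose[OF endo_right[of a] endo_ev[of q]]])
    also have "tr (\<lambda>w. B a (B b (ev q w))) - \<dots> = - tr (\<lambda>w. B a (B (ev q b) w))"
      unfolding q(3) B_add tr_add by simp
    finally show ?thesis using tr0[OF that(1) Qb] by simp
  qed
  have "tr (\<lambda>w. B y (ev q w)) = 0" if "y \<in> span {B u v | u v. u \<in> S \<and> v \<in> S}" for y
    using that
  proof (induction rule: span_induct_alt)
    case base
    then show ?case by (simp add: B_zero tr_zero)
  next
    case (step c y z)
    then show ?case using zero by (auto simp: B_add B_scale tr_add tr_scale)
  qed
  then show ?thesis using x nilpotent_if_tr_conj_eq_0 q(2) by blast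
qed

end

section \<open>Complexification\<close>

text \<open>The pair \<open>(u, v)\<close> stands for u + iv in the complexification.\<close>

definition cscale :: "complex \<Rightarrow> 'a::real_vector \<times> 'a \<Rightarrow> 'a \<times> 'a" where
  "cscale c z = (Re c *\<^sub>R fst z - Im c *\<^sub>R snd z, Re c *\<^sub>R snd z + Im c *\<^sub>R fst z)"

definition cBasis :: "('a::euclidean_space \<times> 'a) set" where
  "cBasis = (\<lambda>b. (b, 0)) ` Basis"

definition cbr :: "('a::real_vector \<Rightarrow> 'a \<Rightarrow> 'a) \<Rightarrow> 'a \<times> 'a \<Rightarrow> 'a \<times> 'a \<Rightarrow> 'a \<times> 'a" where
  "cbr br z w = (br (fst z) (fst w) - br (snd z) (snd w), br (fst z) (snd w) + br (snd z) (fst w))"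

interpretation cplx: vector_space "cscale :: complex \<Rightarrow> 'a::real_vector \<times> 'a \<Rightarrow> 'a \<times> 'a"
  by unfold_locales (simp_all add: cscale_def prod_eq_iff algebra_simps)

lemma mem_cBasis: "b \<in> Basis \<Longrightarrow> (b, 0) \<in> cBasis"
  by (simp add: cBasis_def)

lemma sum_cBasis: "(\<Sum>z\<in>cBasis. f z) = (\<Sum>b\<in>Basis. f (b, 0))"
  unfolding cBasis_def by (subst sum.reindex) (auto simp: inj_on_def)

lemma cBasis_expansion: "(\<Sum>b\<in>Basis. cscale (Complex (u \<bullet> b) (v \<bullet> b)) (b, 0)) = (u, v)"
  by (simp add: cscale_def prod_eq_iff fst_sum snd_sum euclidean_representation)

interpretation cplx: complex_fdvs
  "cscale :: complex \<Rightarrow> 'a::euclidean_space \<times> 'a \<Rightarrow> 'a \<times> 'a" cBasis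
proof unfold_locales
  show fin: "finite (cBasis :: ('a \<times> 'a) set)" by (simp add: cBasis_def)
  show "cplx.independent (cBasis :: ('a \<times> 'a) set)"
    unfolding cplx.dependent_finite[OF fin]
  proof safe
    fix u :: "'a \<times> 'a \<Rightarrow> complex" and x y :: 'a
    assume 0: "(\<Sum>v\<in>cBasis. cscale (u v) v) = 0" and xy: "(x, y) \<in> cBasis" "u (x, y) \<noteq> 0"
    have x: "x \<in> Basis" "y = 0" using xy by (auto simp: cBasis_def)
    have "(\<Sum>b\<in>Basis. Re (u (b, 0)) *\<^sub>R b) = 0" "(\<Sum>b\<in>Basis. Im (u (b, 0)) *\<^sub>R b) = 0"
      using 0 by (simp_all add: sum_cBasis cscale_def prod_eq_iff fst_sum snd_sum)
    then have "(\<Sum>b\<in>Basis. Re (u (b, 0)) *\<^sub>R b) \<bullet> x = 0" "(\<Sum>b\<in>Basis. Im (u (b, 0)) *\<^sub>R b) \<bullet> x = 0"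
      by simp_all
    then have "Re (u (x, 0)) = 0" "Im (u (x, 0)) = 0"
      using x by (simp_all only: inner_sum_left_Basis)
    then show False using xy x by (simp add: complex_eq_iff)
  qed
  show "cplx.span cBasis = (UNIV :: ('a \<times> 'a) set)"
  proof (intro equalityI subsetI UNIV_I)
    fix z :: "'a \<times> 'a"
    have "(\<Sum>b\<in>Basis. cscale (Complex (fst z \<bullet> b) (snd z \<bullet> b)) (b, 0)) \<in> cplx.span cBasis"
      by (intro cplx.span_sum cplx.span_scale cplx.span_base) (rule mem_cBasis)
    then show "z \<in> cplx.span cBasis" unfolding cBasis_expansion by simp
  qed
qed

lemma cplx_representation:
  fixes z :: "'a::euclidean_space \<times> 'a"
  assumes "b \<in> Basis"
  shows "cplx.representation cBasis z (b, 0) = Complex (fst z \<bullet> b) (snd z \<bullet> b)"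
proof -
  have "cplx.representation cBasis z (b, 0)
      = cplx.representation cBasis (\<Sum>c\<in>Basis. cscale (Complex (fst z \<bullet> c) (snd z \<bullet> c)) (c, 0)) (b, 0)"
    by (simp add: cBasis_expansion)
  also have "\<dots> = (\<Sum>c\<in>Basis. Complex (fst z \<bullet> c) (snd z \<bullet> c) * cplx.representation cBasis (c, 0) (b, 0))"
    by (rule cplx.representation_combination) (auto simp: cplx.independent_Basis cplx.span_Basis)
  also have "\<dots> = (\<Sum>c\<in>Basis. if b = c then Complex (fst z \<bullet> c) (snd z \<bullet> c) else 0)"
    by (rule sum.cong) (auto simp: cplx.representation_basis[OF cplx.independent_Basis] mem_cBasis)
  also have "\<dots> = Complex (fst z \<bullet> b) (snd z \<bullet> b)"
    using assms by simp
  finally show ?thesis .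
qed

lemma cplx_tr:
  fixes F :: "'a::euclidean_space \<times> 'a \<Rightarrow> 'a \<times> 'a"
  shows "cplx.tr F = Complex (\<Sum>b\<in>Basis. fst (F (b, 0)) \<bullet> b) (\<Sum>b\<in>Basis. snd (F (b, 0)) \<bullet> b)"
  unfolding cplx.tr_on_def sum_cBasis
  by (simp add: cplx_representation complex_eq_iff)

section \<open>Cartan's criterion and Engel's theorem\<close>

lemma subspace_dim_less:
  fixes S T :: "'a::euclidean_space set"
  shows "subspace S \<Longrightarrow> subspace T \<Longrightarrow> S \<subset> T \<Longrightarrow> dim S < dim T"
  by (metis dim_psubset span_eq_iff)

locale real_lie_algebra =
  fixes br :: "'a::euclidean_space \<Rightarrow> 'a \<Rightarrow> 'a"
  assumes lie: "lie_algebra br"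
begin

lemma linear_right: "linear (br x)" and linear_left: "linear (\<lambda>x. br x y)"
  using lie by (auto simp: lie_algebra_def bilinear_def)

lemmas br_add = linear_add[OF linear_left] linear_add[OF linear_right]
lemmas br_diff = linear_diff[OF linear_left] linear_diff[OF linear_right]
lemmas br_scale = linear_scale[OF linear_left] linear_scale[OF linear_right]
lemmas br_zero = linear_0[OF linear_left] linear_0[OF linear_right]
lemmas br_sum = linear_sum[OF linear_left] linear_sum[OF linear_right]

lemma br_self [simp]: "br x x = 0"
  using lie by (simp add: lie_algebra_def)

lemma br_anti: "br x y = - br y x"
proof -
  have "br (x + y) (x + y) = 0" by (rule br_self)
  then show ?thesis unfolding br_add by (simp add: eq_neg_iff_add_eq_0 add.commute)
qed

lemma br_leibniz: "br x (br y z) = br (br x y) z + br y (br x z)"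
proof -
  have "br x (br y z) + br y (br z x) + br z (br x y) = 0"
    using lie unfolding lie_algebra_def by blast
  moreover have "br y (br z x) = - br y (br x z)"
    using br_anti[of z x] linear_neg[OF linear_right] by simp
  moreover have "br z (br x y) = - br (br x y) z" by (rule br_anti)
  ultimately show ?thesis by (simp add: algebra_simps)
qed

text \<open>The Killing form of the whole Lie algebra. On a subalgebra it is the trace form of the
  adjoint action on the whole space, in general not the Killing form of the subalgebra.\<close>

definition tform :: "'a \<Rightarrow> 'a \<Rightarrow> real" where
  "tform x y = (\<Sum>b\<in>Basis. br x (br y b) \<bullet> b)"

definition ad_nilpotent :: "'a \<Rightarrow> bool" where
  "ad_nilpotent x \<longleftrightarrow> (\<exists>M. \<forall>v. (br x ^^ M) v = 0)"

abbreviation derived :: "'a set \<Rightarrow> 'a set" where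
  "derived S \<equiv> span {br x y | x y. x \<in> S \<and> y \<in> S}"

lemma leibniz_cbr: "leibniz_algebra cscale cBasis (cbr br)"
proof (intro leibniz_algebra.intro leibniz_algebra_axioms.intro cplx.endoI cplx.complex_fdvs_axioms)
  show "cbr br x (cbr br u v) = cbr br (cbr br x u) v + cbr br u (cbr br x v)" for x u v
    unfolding cbr_def prod_eq_iff
    by (simp add: br_add br_diff br_leibniz[of "fst x"] br_leibniz[of "snd x"])
qed (simp_all add: cbr_def cscale_def prod_eq_iff br_add br_diff br_scale algebra_simps)

text \<open>The eigenvalue argument needs complex scalars: \<open>S \<times> S\<close> is the
  complexification of \<open>S\<close>, and its trace form, the complex bilinear extension of
  \<open>tform\<close>, still vanishes.\<close>

lemma ad_nilpotent_derived:
  assumes S: "lie_subalgebra br S" and t: "\<And>u v. u \<in> S \<Longrightarrow> v \<in> S \<Longrightarrow> tform u v = 0"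
    and x: "x \<in> derived S"
  shows "ad_nilpotent x"
proof -
  interpret leibniz_algebra cscale cBasis "cbr br" by (rule leibniz_cbr)
  have sub: "subspace S" and cl: "\<And>u v. u \<in> S \<Longrightarrow> v \<in> S \<Longrightarrow> br u v \<in> S"
    using S by (auto simp: lie_subalgebra_def)
  let ?S = "S \<times> S" let ?G = "{cbr br u v | u v. u \<in> ?S \<and> v \<in> ?S}"
  have "cplx.subspace ?S"
    unfolding cplx.subspace_def using sub
    by (auto simp: cscale_def subspace_0 subspace_add subspace_diff subspace_scale zero_prod_def)
  moreover have "cbr br u v \<in> ?S" if "u \<in> ?S" "v \<in> ?S" for u v
    using that cl sub by (auto simp: cbr_def subspace_add subspace_diff)
  moreover have "cplx.tr (\<lambda>w. cbr br u (cbr br v w)) = 0" if "u \<in> ?S" "v \<in> ?S" for u v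
  proof -
    have "cplx.tr (\<lambda>w. cbr br u (cbr br v w))
        = Complex (tform (fst u) (fst v) - tform (snd u) (snd v)) (tform (fst u) (snd v) + tform (snd u) (fst v))"
      unfolding cplx_tr tform_def
      by (simp add: cbr_def br_zero inner_diff_left inner_add_left sum_subtractf sum.distrib)
    then show ?thesis using t that by (auto simp: complex_eq_iff)
  qed
  moreover have "(x, 0) \<in> cplx.span ?G"
    using x
  proof (induction rule: span_induct_alt)
    case base
    then show ?case using cplx.span_zero by (simp add: zero_prod_def)
  next
    case (step c y z)
    obtain u v where uv: "y = br u v" "u \<in> S" "v \<in> S" using step by auto
    have "cbr br (u, 0) (v, 0) = (y, 0)" using uv by (simp add: cbr_def br_zero)
    then have "(y, 0) \<in> ?G" using uv subspace_0[OF sub] by force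
    moreover have "(z, 0) \<in> cplx.span ?G" using step by blast
    ultimately have "cscale (complex_of_real c) (y, 0) + (z, 0) \<in> cplx.span ?G"
      by (rule cplx.span_add[OF cplx.span_scale[OF cplx.span_base]])
    moreover have "cscale (complex_of_real c) (y, 0) + (z, 0) = (c *\<^sub>R y + z, 0)"
      by (simp add: cscale_def)
    ultimately show ?case by (simp only:)
  qed
  ultimately obtain M where M: "\<And>v. (cbr br (x, 0) ^^ M) v = 0"
    using cartan_nilpotency[of ?S "(x, 0)"] by blast
  have "(cbr br (x, 0) ^^ i) (v, 0) = ((br x ^^ i) v, 0)" for i v
    by (induction i) (simp_all add: cbr_def br_zero)
  then show ?thesis unfolding ad_nilpotent_def using M by (metis fst_conv fst_zero)
qed

section \<open>Engel's theorem and solvability from nilpotent adjoint maps\<close>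

text \<open>As \<open>br z z\<close> vanishes, brackets of the enlarged space fall back into
  \<open>N\<close>, which makes it a subalgebra and also bounds its derived algebra.\<close>

lemma lie_subalgebra_extend:
  assumes N: "lie_subalgebra br N" and z: "\<And>x. x \<in> N \<Longrightarrow> br x z \<in> N"
  shows "lie_subalgebra br {x + t *\<^sub>R z | x t. x \<in> N}"
    and "\<And>u v. u \<in> {x + t *\<^sub>R z | x t. x \<in> N} \<Longrightarrow> v \<in> {x + t *\<^sub>R z | x t. x \<in> N} \<Longrightarrow> br u v \<in> N"
proof -
  let ?N = "{x + t *\<^sub>R z | x t. x \<in> N}"
  have sub: "subspace N" and cl: "\<And>u v. u \<in> N \<Longrightarrow> v \<in> N \<Longrightarrow> br u v \<in> N"
    using N by (auto simp: lie_subalgebra_def)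
  have z': "br z x \<in> N" if "x \<in> N" for x
    using z[OF that] br_anti[of z x] subspace_neg[OF sub] by simp
  show br: "br u v \<in> N" if "u \<in> ?N" "v \<in> ?N" for u v
  proof -
    obtain x s y t where "u = x + s *\<^sub>R z" "v = y + t *\<^sub>R z" "x \<in> N" "y \<in> N"
      using \<open>u \<in> ?N\<close> \<open>v \<in> ?N\<close> by auto
    then show ?thesis
      by (simp add: br_add br_scale subspace_add[OF sub] subspace_scale[OF sub] cl z z')
  qed
  have "N \<subseteq> ?N" by force
  moreover have "subspace ?N"
  proof (rule subspaceI)
    show "0 \<in> ?N" using subspace_0[OF sub] \<open>N \<subseteq> ?N\<close> by blast
    show "u + v \<in> ?N" if "u \<in> ?N" "v \<in> ?N" for u v
    proof -
      obtain x s y t where "u = x + s *\<^sub>R z" "v = y + t *\<^sub>R z" "x \<in> N" "y \<in> N" using \<open>u \<in> ?N\<close> \<open>v \<in> ?N\<close> by auto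
      then have "u + v = (x + y) + (s + t) *\<^sub>R z" "x + y \<in> N"
        using subspace_add[OF sub] by (auto simp: algebra_simps)
      then show ?thesis by blast
    qed
    show "c *\<^sub>R u \<in> ?N" if "u \<in> ?N" for c u
    proof -
      obtain x s where "u = x + s *\<^sub>R z" "x \<in> N" using \<open>u \<in> ?N\<close> by auto
      then have "c *\<^sub>R u = c *\<^sub>R x + (c * s) *\<^sub>R z" "c *\<^sub>R x \<in> N"
        using subspace_scale[OF sub] by (auto simp: algebra_simps)
      then show ?thesis by blast
    qed
  qed
  ultimately show "lie_subalgebra br ?N" unfolding lie_subalgebra_def using br by blast
qed

text \<open>Take a proper subalgebra of largest dimension. Adjoining the vector supplied by
  \<open>step\<close> gives a larger subalgebra, hence all of \<open>L\<close>.\<close>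

lemma codim_one_subalgebra:
  assumes L: "lie_subalgebra br L" "L \<noteq> {0}"
    and step: "\<And>N. lie_subalgebra br N \<Longrightarrow> N \<subset> L \<Longrightarrow> \<exists>z\<in>L - N. \<forall>x\<in>N. br x z \<in> N"
  shows "\<exists>N z. lie_subalgebra br N \<and> N \<subset> L \<and> z \<in> L \<and> (\<forall>x\<in>N. br x z \<in> N) \<and>
    L = {x + t *\<^sub>R z | x t. x \<in> N}"
proof -
  let ?P = "\<lambda>N. lie_subalgebra br N \<and> N \<subset> L"
  have subL: "subspace L" using L by (simp add: lie_subalgebra_def)
  have "?P {0}" using L subspace_0[OF subL] by (auto simp: lie_subalgebra_def)
  moreover have "\<forall>N. ?P N \<longrightarrow> dim N < Suc (dim L)"
    using dim_subset by (auto simp: less_Suc_eq_le)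
  ultimately obtain N where N: "?P N" "\<And>N'. ?P N' \<Longrightarrow> dim N' \<le> dim N"
    using ex_has_greatest_nat[of ?P "{0}" dim "Suc (dim L)"] by blast
  obtain z where z: "z \<in> L" "z \<notin> N" "\<And>x. x \<in> N \<Longrightarrow> br x z \<in> N" using step[of N] N(1) by blast
  let ?N = "{x + t *\<^sub>R z | x t. x \<in> N}"
  have ext: "lie_subalgebra br ?N" using lie_subalgebra_extend(1)[of N z] N(1) z(3) by blast
  have NL: "?N \<subseteq> L" using N(1) z(1) subspace_add[OF subL] subspace_scale[OF subL] by blast
  have "z \<in> ?N" using N(1) subspace_0[of N] unfolding lie_subalgebra_def
    by (metis (mono_tags, lifting) add_0 mem_Collect_eq scaleR_one)
  moreover have "N \<subseteq> ?N" by force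
  ultimately have "N \<subset> ?N" using z(2) by blast
  then have "dim N < dim ?N"
    using N(1) ext by (intro subspace_dim_less) (auto simp: lie_subalgebra_def)
  then have "?N = L" using N(2)[of ?N] ext NL by force
  then show ?thesis using N(1) z by blast
qed

text \<open>This is the common null vector for the action of \<open>L\<close> on the quotient of
  \<open>W\<close> by \<open>U\<close>, stated without forming quotients. By induction a subalgebra
  \<open>N\<close> of codimension one has such a vector, and applying the remaining direction
  \<open>z\<close> repeatedly ends with one that \<open>z\<close> kills as well.\<close>

lemma engel:
  assumes "lie_subalgebra br L" "\<And>x. x \<in> L \<Longrightarrow> ad_nilpotent x"
    "subspace U" "subspace W" "U \<subset> W"
    "\<And>x u. x \<in> L \<Longrightarrow> u \<in> U \<Longrightarrow> br x u \<in> U" "\<And>x u. x \<in> L \<Longrightarrow> u \<in> W \<Longrightarrow> br x u \<in> W"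
  shows "\<exists>v\<in>W - U. \<forall>x\<in>L. br x v \<in> U"
  using assms
proof (induction "dim L" arbitrary: L U W rule: less_induct)
  case less
  show ?case
  proof (cases "L = {0}")
    case True
    then show ?thesis using less.prems(3,5) by (auto simp: br_zero subspace_0)
  next
    case False
    have subL: "subspace L" and clL: "\<And>u v. u \<in> L \<Longrightarrow> v \<in> L \<Longrightarrow> br u v \<in> L"
      using less.prems(1) by (auto simp: lie_subalgebra_def)
    have dimlt: "dim N < dim L" if "lie_subalgebra br N" "N \<subset> L" for N
      using that subL by (intro subspace_dim_less) (auto simp: lie_subalgebra_def)
    \<comment> \<open>The induction hypothesis is applied to the action of \<open>N\<close> on the
      quotient of \<open>L\<close> by \<open>N\<close>.\<close>
    have step: "\<exists>z\<in>L - N. \<forall>x\<in>N. br x z \<in> N" if N: "lie_subalgebra br N" "N \<subset> L" for N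
      using N less.prems(2) subL clL
      by (intro less.hyps[OF dimlt[OF N] N(1)]) (auto simp: lie_subalgebra_def)
    obtain N z where N: "lie_subalgebra br N" "N \<subset> L" "z \<in> L" "\<And>x. x \<in> N \<Longrightarrow> br x z \<in> N"
      "L = {x + t *\<^sub>R z | x t. x \<in> N}"
      using codim_one_subalgebra[OF less.prems(1) False step] by blast
    have "\<exists>v\<in>W - U. \<forall>x\<in>N. br x v \<in> U"
      using N(2) less.prems by (intro less.hyps[OF dimlt[OF N(1,2)] N(1)]) auto
    then obtain w where w: "w \<in> W" "w \<notin> U" "\<And>x. x \<in> N \<Longrightarrow> br x w \<in> U" by blast
    let ?w = "\<lambda>i. (br z ^^ i) w"
    have inv: "?w i \<in> W \<and> (\<forall>x\<in>N. br x (?w i) \<in> U)" for i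
    proof (induction i)
      case 0
      then show ?case using w by simp
    next
      case (Suc i)
      have "br x (br z (?w i)) \<in> U" if "x \<in> N" for x
        unfolding br_leibniz[of x z]
        using Suc N(3,4) that less.prems(3,6) by (blast intro: subspace_add)
      then show ?case using Suc N(3) less.prems(7) by simp
    qed
    obtain M where "(br z ^^ M) w = 0"
      using less.prems(2)[OF N(3)] unfolding ad_nilpotent_def by blast
    then have ex: "?w M \<in> U" using subspace_0[OF less.prems(3)] by simp
    \<comment> \<open>The iterate just before the first one in \<open>U\<close> is the required
      vector; it exists because \<open>w\<close> itself is not in \<open>U\<close>.\<close>
    define i where "i = (LEAST i. ?w i \<in> U)"
    have i: "?w i \<in> U" "\<And>j. j < i \<Longrightarrow> ?w j \<notin> U"
      unfolding i_def using LeastI[of "\<lambda>i. ?w i \<in> U", OF ex] not_less_Least by blast+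
    obtain j where j: "i = Suc j" using i(1) w(2) by (cases i) auto
    have "br x (?w j) \<in> U" if "x \<in> L" for x
    proof -
      obtain y t where y: "x = y + t *\<^sub>R z" "y \<in> N" using \<open>x \<in> L\<close> N(5) by auto
      have "br z (?w j) \<in> U" using i(1) j by simp
      then show ?thesis using y inv[of j] less.prems(3)
        by (simp add: br_add br_scale subspace_add subspace_scale)
    qed
    moreover have "?w j \<in> W - U" using inv[of j] i(2)[of j] j by simp
    ultimately show ?thesis by blast
  qed
qed

text \<open>Engel's theorem yields a subalgebra of codimension one that contains all brackets of
  \<open>L\<close>.\<close>

lemma derived_psubset:
  assumes L: "lie_subalgebra br L" "\<And>x. x \<in> L \<Longrightarrow> ad_nilpotent x" "L \<noteq> {0}"
  shows "derived L \<subset> L"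
proof -
  have subL: "subspace L" and clL: "\<And>u v. u \<in> L \<Longrightarrow> v \<in> L \<Longrightarrow> br u v \<in> L"
    using L(1) by (auto simp: lie_subalgebra_def)
  have step: "\<exists>z\<in>L - N. \<forall>x\<in>N. br x z \<in> N" if N: "lie_subalgebra br N" "N \<subset> L" for N
    using N L(2) subL clL by (intro engel[OF N(1)]) (auto simp: lie_subalgebra_def)
  obtain N z where N: "lie_subalgebra br N" "N \<subset> L" "z \<in> L" "\<And>x. x \<in> N \<Longrightarrow> br x z \<in> N"
    "L = {x + t *\<^sub>R z | x t. x \<in> N}"
    using codim_one_subalgebra[OF L(1,3) step] by blast
  have "{br x y | x y. x \<in> L \<and> y \<in> L} \<subseteq> N"
    using lie_subalgebra_extend(2)[OF N(1,4)] N(5) by blast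
  then have "derived L \<subseteq> N" using N(1) by (intro span_minimal) (auto simp: lie_subalgebra_def)
  then show ?thesis using N(2) by blast
qed

lemma lie_subalgebra_derived:
  assumes "lie_subalgebra br S"
  shows "lie_subalgebra br (derived S)" "derived S \<subseteq> S"
proof -
  show sub: "derived S \<subseteq> S" using assms by (intro span_minimal) (auto simp: lie_subalgebra_def)
  show "lie_subalgebra br (derived S)"
    unfolding lie_subalgebra_def using sub by (auto intro!: span_base)
qed

lemma solvable_if_derived_ad_nilpotent:
  assumes S: "lie_subalgebra br S" and nil: "\<And>x. x \<in> derived S \<Longrightarrow> ad_nilpotent x"
  shows "solvable_lie br S"
proof -
  \<comment> \<open>Nilpotency is known only on the derived algebra, so the strict decrease of
    dimension is counted from the first derived term.\<close>
  let ?D = "\<lambda>i. derived_series br S (Suc i)"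
  have D: "lie_subalgebra br (?D i) \<and> ?D i \<subseteq> derived S" for i
  proof (induction i)
    case 0
    show ?case using lie_subalgebra_derived(1)[OF S] by simp
  next
    case (Suc i)
    have eq: "?D (Suc i) = derived (?D i)" by simp
    show ?case unfolding eq using lie_subalgebra_derived[of "?D i"] Suc by blast
  qed
  have "?D i = {0} \<or> dim (?D i) + i \<le> dim (derived S)" for i
  proof (induction i)
    case 0
    show ?case by simp
  next
    case (Suc i)
    have eq: "?D (Suc i) = derived (?D i)" by simp
    show ?case
    proof (cases "?D i = {0}")
      case True
      have "{br x y | x y. x \<in> ?D i \<and> y \<in> ?D i} \<subseteq> {0}" unfolding True by (auto simp: br_zero)
      then have "derived (?D i) \<subseteq> {0}" by (rule span_minimal) (rule subspace_single_0)
      then show ?thesis unfolding eq using span_zero by blast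
    next
      case False
      have "derived (?D i) \<subset> ?D i" using D[of i] nil by (intro derived_psubset False) auto
      then have "dim (derived (?D i)) < dim (?D i)"
        using D[of i] by (intro subspace_dim_less) (auto simp: lie_subalgebra_def)
      then show ?thesis using Suc False unfolding eq by simp
    qed
  qed
  from this[of "Suc (dim (derived S))"] have "?D (Suc (dim (derived S))) = {0}"
    by (auto simp del: derived_series.simps)
  then show ?thesis unfolding solvable_lie_def by blast
qed

section \<open>Invariance and nondegeneracy of the trace form, and perfectness\<close>

lemma trace_swap:
  fixes f h :: "'a \<Rightarrow> 'a"
  assumes "linear f" "linear h"
  shows "(\<Sum>b\<in>Basis. f (h b) \<bullet> b) = (\<Sum>b\<in>Basis. h (f b) \<bullet> b)"
proof -
  have exp: "f (h b) \<bullet> b = (\<Sum>c\<in>Basis. (h b \<bullet> c) * (f c \<bullet> b))" if "linear f" for f h :: "'a \<Rightarrow> 'a" and b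
  proof -
    have "f (h b) = f (\<Sum>c\<in>Basis. (h b \<bullet> c) *\<^sub>R c)" by (simp add: euclidean_representation)
    also have "\<dots> = (\<Sum>c\<in>Basis. (h b \<bullet> c) *\<^sub>R f c)"
      by (simp add: linear_sum[OF that] linear_scale[OF that])
    finally show ?thesis by (simp add: inner_sum_left)
  qed
  have "(\<Sum>b\<in>Basis. f (h b) \<bullet> b) = (\<Sum>b\<in>Basis. \<Sum>c\<in>Basis. (h b \<bullet> c) * (f c \<bullet> b))"
    by (intro sum.cong refl exp assms)
  also have "\<dots> = (\<Sum>c\<in>Basis. \<Sum>b\<in>Basis. (f c \<bullet> b) * (h b \<bullet> c))"
    by (subst sum.swap) (simp add: mult.commute)
  also have "\<dots> = (\<Sum>b\<in>Basis. h (f b) \<bullet> b)"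
    by (intro sum.cong refl exp[symmetric] assms)
  finally show ?thesis .
qed

text \<open>Writing adjoint maps of brackets as commutators leaves two traces that differ by a
  cyclic shift.\<close>

lemma tform_invariant: "tform (br z x) y = tform x (br y z)"
proof -
  have 1: "br (br z x) w = br z (br x w) - br x (br z w)" for z x w
    using br_leibniz[of z x w] by simp
  have "(\<Sum>b\<in>Basis. br z (br x (br y b)) \<bullet> b) = (\<Sum>b\<in>Basis. br x (br y (br z b)) \<bullet> b)"
    by (rule trace_swap[of "br z" "\<lambda>w. br x (br y w)"])
      (auto intro: linear_right linear_compose[unfolded comp_def])
  then show ?thesis
    unfolding tform_def 1 by (simp add: br_diff inner_diff_left sum_subtractf)
qed

lemma bilinear_tform: "bilinear tform"
  unfolding bilinear_def tform_def
  by (auto intro!: linearI simp: br_add br_scale inner_add_left sum.distrib sum_distrib_left)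

end

text \<open>An orthonormal basis for the Euclidean inner product serves to turn
  \<open>\<beta>\<close> into an endomorphism \<open>T\<close> of \<open>K\<close>. Nondegeneracy
  makes \<open>T\<close> injective on \<open>K\<close>, hence onto by dimension.\<close>

lemma nondegenerate_represents_functional:
  fixes \<beta> :: "'a::euclidean_space \<Rightarrow> 'a \<Rightarrow> real"
  assumes K: "subspace K" and \<beta>: "bilinear \<beta>" and \<phi>: "linear \<phi>"
    and nondeg: "\<And>x. x \<in> K \<Longrightarrow> (\<forall>y\<in>K. \<beta> x y = 0) \<Longrightarrow> x = 0"
  shows "\<exists>z\<in>K. \<forall>y\<in>K. \<beta> z y = \<phi> y"
proof -
  obtain A where A: "A \<subseteq> K" "pairwise orthogonal A" "\<And>x. x \<in> A \<Longrightarrow> norm x = 1"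
    "independent A" "card A = dim K" "span A = K"
    using orthonormal_basis_subspace[OF K] by blast
  have fin: "finite A" using A(4) finiteI_independent by blast
  have linl: "linear (\<lambda>x. \<beta> x y)" and linr: "linear (\<beta> x)" for x y
    using \<beta> by (auto simp: bilinear_def)
  have coeff: "(\<Sum>a\<in>A. f a *\<^sub>R a) \<bullet> c = f c" if "c \<in> A" for f c
  proof -
    have "(\<Sum>a\<in>A. f a *\<^sub>R a) \<bullet> c = (\<Sum>a\<in>A. if c = a then f c else 0)"
      unfolding inner_sum_left using A(2,3) that
      by (intro sum.cong) (auto simp: pairwise_def orthogonal_def norm_eq_1)
    then show ?thesis using that fin by simp
  qed
  define T where "T x = (\<Sum>a\<in>A. \<beta> x a *\<^sub>R a)" for x
  have lin: "linear T"
    unfolding T_def by (rule linearI)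
      (simp_all add: linear_add[OF linl] linear_scale[OF linl] scaleR_add_left sum.distrib scaleR_sum_right)
  have inK: "(\<Sum>a\<in>A. f a *\<^sub>R a) \<in> K" for f
    using A(1) K by (intro subspace_sum subspace_scale) auto
  have "x = 0" if "x \<in> K" "T x = 0" for x
  proof (rule nondeg[OF that(1)], rule ballI)
    have 0: "\<beta> x a = 0" if "a \<in> A" for a
      using coeff[OF that, of "\<beta> x"] \<open>T x = 0\<close> unfolding T_def by simp
    show "\<beta> x y = 0" if "y \<in> K" for y
      using linear_eq_0_on_span[OF linr 0] that A(6) by blast
  qed
  then have "inj_on T K" using linear_inj_on_iff_eq_0[OF lin K] by blast
  then have "dim (T ` K) = dim K" using dim_image_eq[OF lin] K by (metis span_eq_iff)
  then have "T ` K = K"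
    using subspace_dim_equal[of "T ` K" K] linear_subspace_image[OF lin K] K inK by (auto simp: T_def)
  then obtain z where z: "z \<in> K" "T z = (\<Sum>a\<in>A. \<phi> a *\<^sub>R a)" using inK[of \<phi>] by (metis imageE)
  have "\<beta> z a = \<phi> a" if "a \<in> A" for a
    using coeff[OF that, of "\<beta> z"] coeff[OF that, of \<phi>] z(2) unfolding T_def by simp
  then have "\<beta> z y = \<phi> y" if "y \<in> K" for y
    using linear_eq_on_span[OF linr \<phi>] that A(6) by blast
  then show ?thesis using z(1) by blast
qed

context real_lie_algebra
begin

text \<open>The radical of the form on \<open>K\<close> is an ideal by invariance and solvable
  because the form vanishes on it.\<close>

lemma semisimple_tform_nondegenerate:
  assumes K: "semisimple_lie br K" and x: "x \<in> K" "\<forall>y\<in>K. tform x y = 0"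
  shows "x = 0"
proof -
  have sub: "subspace K" and cl: "\<And>u v. u \<in> K \<Longrightarrow> v \<in> K \<Longrightarrow> br u v \<in> K"
    using K by (auto simp: semisimple_lie_def lie_subalgebra_def)
  let ?S = "{x\<in>K. \<forall>y\<in>K. tform x y = 0}"
  have lin: "linear (\<lambda>x. tform x y)" for y using bilinear_tform by (simp add: bilinear_def)
  have subS: "subspace ?S"
    using sub by (auto simp: subspace_def linear_0[OF lin] linear_add[OF lin] linear_scale[OF lin])
  have ideal: "lie_ideal_of br K ?S"
    unfolding lie_ideal_of_def using subS cl by (auto simp: tform_invariant)
  then have "lie_subalgebra br ?S" using subS by (auto simp: lie_ideal_of_def lie_subalgebra_def)
  then have "solvable_lie br ?S"
    using ad_nilpotent_derived[of ?S] by (intro solvable_if_derived_ad_nilpotent) auto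
  then have "?S = {0}" using K ideal unfolding semisimple_lie_def by blast
  then show ?thesis using x by blast
qed

text \<open>Otherwise some nonzero \<open>p\<close> in \<open>K\<close> is Euclidean-orthogonal to
  the derived algebra. The element \<open>z\<close> that represents this functional through
  \<open>tform\<close> is central by invariance, so it spans an abelian ideal and is zero; then
  \<open>p\<close> is zero too.\<close>

lemma semisimple_perfect:
  assumes K: "semisimple_lie br K"
  shows "derived K = K"
proof (rule ccontr)
  assume neq: "derived K \<noteq> K"
  have S: "lie_subalgebra br K" using K by (simp add: semisimple_lie_def)
  then have sub: "subspace K" and cl: "\<And>u v. u \<in> K \<Longrightarrow> v \<in> K \<Longrightarrow> br u v \<in> K"
    by (auto simp: lie_subalgebra_def)
  have "span (derived K) \<subset> span K"
    unfolding span_span span_eq_iff[THEN iffD2, OF sub]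
    using lie_subalgebra_derived(2)[OF S] neq by blast
  then obtain p where p: "p \<noteq> 0" "p \<in> span K" "\<And>y. y \<in> span (derived K) \<Longrightarrow> orthogonal p y"
    using orthogonal_to_subspace_exists_gen by blast
  have pK: "p \<in> K" using p(2) unfolding span_eq_iff[THEN iffD2, OF sub] .
  have "linear ((\<bullet>) p)" by (rule bounded_linear.linear[OF bounded_linear_inner_right])
  then obtain z where z: "z \<in> K" "\<And>y. y \<in> K \<Longrightarrow> tform z y = p \<bullet> y"
    using nondegenerate_represents_functional[OF sub bilinear_tform]
      semisimple_tform_nondegenerate[OF K] by blast
  have central: "br a z = 0" if "a \<in> K" for a
  proof (rule semisimple_tform_nondegenerate[OF K cl[OF that z(1)]], rule ballI)
    fix y assume y: "y \<in> K"
    have "br y a \<in> derived K" using that y by (intro span_base) auto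
    then have "p \<bullet> br y a = 0" using p(3) span_base unfolding orthogonal_def by blast
    then show "tform (br a z) y = 0" using z(2)[OF cl[OF y that]] by (simp add: tform_invariant)
  qed
  have "lie_ideal_of br K (span {z})"
    unfolding lie_ideal_of_def
  proof (intro conjI ballI)
    show "span {z} \<subseteq> K" using z(1) sub by (intro span_minimal) auto
    show "br x y \<in> span {z}" if "x \<in> K" "y \<in> span {z}" for x y
      using that central[OF that(1)] by (auto simp: span_singleton br_scale)
  qed (rule subspace_span)
  moreover have "solvable_lie br (span {z})"
  proof -
    have "{br x y | x y. x \<in> span {z} \<and> y \<in> span {z}} \<subseteq> {0}"
      by (auto simp: span_singleton br_scale)
    then have "derived (span {z}) \<subseteq> {0}" by (rule span_minimal) (rule subspace_single_0)
    then have "derived_series br (span {z}) (Suc 0) = {0}" using span_zero by auto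
    then show ?thesis unfolding solvable_lie_def by blast
  qed
  ultimately have "span {z} = {0}" using K unfolding semisimple_lie_def by blast
  then have "z = 0" using span_base by blast
  then have "p \<bullet> p = 0" using z(2)[OF pK] bilinear_tform by (simp add: bilinear_lzero)
  then show False using p(1) by simp
qed

end

section \<open>Conformal foliations\<close>

lemma orth_proj_eqI:
  assumes g: "bilinear g" and S: "subspace S"
    and nondeg: "\<And>y. y \<in> S \<Longrightarrow> (\<forall>z\<in>S. g y z = 0) \<Longrightarrow> y = 0"
    and y: "y \<in> S" "\<And>z. z \<in> S \<Longrightarrow> g (x - y) z = 0"
  shows "orth_proj g S x = y"
  unfolding orth_proj_def
proof (rule the_equality)
  fix y' assume y': "y' \<in> S \<and> (\<forall>z\<in>S. g (x - y') z = 0)"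
  have "g (y' - y) z = 0" if "z \<in> S" for z
    using y(2)[OF that] y' that bilinear_lsub[OF g, of x y z] bilinear_lsub[OF g, of x y' z]
      bilinear_lsub[OF g, of y' y z] by auto
  then have "y' - y = 0" using nondeg[of "y' - y"] subspace_diff[OF S] y(1) y' by blast
  then show "y' = y" by simp
qed (use y in blast)

text \<open>A skew endomorphism of a plane is determined by one number, so two conformal
  endomorphisms are linear combinations of the identity and a single skew endomorphism.\<close>

lemma plane_conformal_endomorphisms_commute:
  fixes g :: "'a::euclidean_space \<Rightarrow> 'a \<Rightarrow> real"
  assumes g: "bilinear g" "\<And>x y. g x y = g y x"
    and m: "subspace m" "dim m = 2" "\<And>x. x \<in> m \<Longrightarrow> (\<forall>y\<in>m. g x y = 0) \<Longrightarrow> x = 0"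
    and A: "linear A" "\<And>x. x \<in> m \<Longrightarrow> A x \<in> m"
      "\<And>x y. x \<in> m \<Longrightarrow> y \<in> m \<Longrightarrow> g (A x) y + g (A y) x = 2 * c * g x y"
    and A': "linear A'" "\<And>x. x \<in> m \<Longrightarrow> A' x \<in> m"
      "\<And>x y. x \<in> m \<Longrightarrow> y \<in> m \<Longrightarrow> g (A' x) y + g (A' y) x = 2 * c' * g x y"
    and x: "x \<in> m"
  shows "A (A' x) = A' (A x)"
proof -
  note bil = bilinear_ladd[OF g(1)] bilinear_radd[OF g(1)] bilinear_lmul[OF g(1)]
    bilinear_rmul[OF g(1)] bilinear_lsub[OF g(1)] bilinear_rsub[OF g(1)]
  obtain C where C: "C \<subseteq> m" "m \<subseteq> span C" "card C = 2"
    using basis_exists[of m] m(2) by metis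
  obtain e f where ef: "C = {e, f}" using C(3) by (auto simp: card_2_iff)
  have em: "e \<in> m" "f \<in> m" using C(1) ef by auto
  have coord: "\<exists>a b. y = a *\<^sub>R e + b *\<^sub>R f" if "y \<in> m" for y
  proof -
    obtain a b where "y - a *\<^sub>R e = b *\<^sub>R f"
      using \<open>y \<in> m\<close> C(2) unfolding ef span_insert[of e "{f}"] span_singleton by blast
    then have "y = a *\<^sub>R e + b *\<^sub>R f" by (simp add: algebra_simps)
    then show ?thesis by blast
  qed
  define S where "S y = A y - c *\<^sub>R y" for y
  define S' where "S' y = A' y - c' *\<^sub>R y" for y
  have Sm: "S y \<in> m" "S' y \<in> m" if "y \<in> m" for y
    using that A(2) A'(2) m(1) by (auto simp: S_def S'_def subspace_diff subspace_scale)
  have lin: "linear S" "linear S'"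
    using A(1) A'(1) by (auto intro!: linearI simp: S_def S'_def linear_add linear_scale algebra_simps)
  have skew: "g (S y) z = - g (S z) y" "g (S' y) z = - g (S' z) y" if "y \<in> m" "z \<in> m" for y z
    using A(3)[OF that] A'(3)[OF that] g(2)[of y z] by (simp_all add: S_def S'_def bil)
  define t where "t = g (S e) f"
  define t' where "t' = g (S' e) f"
  \<comment> \<open>A skew form on a plane is a multiple of the coordinate determinant, so its value
    at \<open>e\<close>, \<open>f\<close> determines it.\<close>
  have form: "g (T (a *\<^sub>R e + b *\<^sub>R f)) (a' *\<^sub>R e + b' *\<^sub>R f) = (a * b' - b * a') * g (T e) f"
    if "linear T" "\<And>y z. y \<in> m \<Longrightarrow> z \<in> m \<Longrightarrow> g (T y) z = - g (T z) y" for T a b a' b'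
  proof -
    have "g (T e) e = 0" "g (T f) f = 0" "g (T f) e = - g (T e) f"
      using that(2)[OF em(1) em(1)] that(2)[OF em(2) em(2)] that(2)[OF em(2) em(1)] by auto
    then show ?thesis
      by (simp add: linear_add[OF that(1)] linear_scale[OF that(1)] bil algebra_simps)
  qed
  have proportional: "t' *\<^sub>R S y = t *\<^sub>R S' y" if "y \<in> m" for y
  proof -
    have "t' *\<^sub>R S y - t *\<^sub>R S' y \<in> m"
      using Sm[OF that] m(1) by (intro subspace_diff subspace_scale)
    moreover have "g (t' *\<^sub>R S y - t *\<^sub>R S' y) z = 0" if "z \<in> m" for z
    proof -
      obtain a b where y: "y = a *\<^sub>R e + b *\<^sub>R f" using coord \<open>y \<in> m\<close> by blast
      obtain a' b' where z: "z = a' *\<^sub>R e + b' *\<^sub>R f" using coord \<open>z \<in> m\<close> by blast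
      have "g (S y) z = (a * b' - b * a') * t" "g (S' y) z = (a * b' - b * a') * t'"
        unfolding y z t_def t'_def by (rule form; use lin skew in blast)+
      then show ?thesis by (simp add: bil)
    qed
    ultimately have "t' *\<^sub>R S y - t *\<^sub>R S' y = 0" using m(3) by blast
    then show ?thesis by simp
  qed
  show ?thesis
  \<comment> \<open>If \<open>t\<close> is 0 then \<open>A\<close> is a scalar on \<open>m\<close>;
    otherwise \<open>A'\<close> is a linear combination of the identity and
    \<open>A\<close>.\<close>
  proof (cases "t = 0")
    case True
    have S0: "S y = 0" if "y \<in> m" for y
    proof (rule m(3)[OF Sm(1)[OF that]], rule ballI)
      fix z assume "z \<in> m"
      then obtain a b a' b' where "y = a *\<^sub>R e + b *\<^sub>R f" "z = a' *\<^sub>R e + b' *\<^sub>R f"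
        using coord \<open>y \<in> m\<close> by blast
      then show "g (S y) z = 0"
        using form[OF lin(1) skew(1), of a b a' b'] True by (simp add: t_def)
    qed
    have "A y = c *\<^sub>R y" if "y \<in> m" for y using S0[OF that] by (simp add: S_def)
    then show ?thesis using x A'(2) by (simp add: linear_scale[OF A'(1)])
  next
    case False
    define s where "s = t' / t"
    have A'_eq: "A' y = c' *\<^sub>R y + s *\<^sub>R (A y - c *\<^sub>R y)" if "y \<in> m" for y
    proof -
      have "S' y = (1 / t) *\<^sub>R (t *\<^sub>R S' y)" using False by simp
      also have "\<dots> = s *\<^sub>R S y" unfolding proportional[OF that, symmetric] by (simp add: s_def)
      finally show ?thesis by (simp add: S_def S'_def algebra_simps)
    qed
    show ?thesis
      unfolding A'_eq[OF x] A'_eq[OF A(2)[OF x]]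
      by (simp add: linear_add[OF A(1)] linear_scale[OF A(1)] linear_diff[OF A(1)])
  qed
qed

text \<open>The assumption \<open>split\<close> states existence only. Uniqueness follows from
  orthogonality and nondegeneracy of \<open>g\<close>, through \<open>K_inter_m\<close>.\<close>

locale conformal_splitting = real_lie_algebra br
  for br :: "'a::euclidean_space \<Rightarrow> 'a \<Rightarrow> 'a" +
  fixes g :: "'a \<Rightarrow> 'a \<Rightarrow> real" and K m :: "'a set"
  assumes metric: "semi_riem_metric g"
    and subalg: "lie_subalgebra br K"
    and m_sub: "subspace m"
    and orth: "\<And>x y. x \<in> K \<Longrightarrow> y \<in> m \<Longrightarrow> g x y = 0"
    and split: "\<And>z. \<exists>x\<in>K. \<exists>y\<in>m. z = x + y"
    and conformal: "conformal_foliation br g K m"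
begin

lemma g_bilinear: "bilinear g" and g_sym: "g x y = g y x"
  and g_nondeg: "(\<And>y. g x y = 0) \<Longrightarrow> x = 0"
  using metric by (auto simp: semi_riem_metric_def)

lemmas g_simps = bilinear_ladd[OF g_bilinear] bilinear_radd[OF g_bilinear]
  bilinear_lmul[OF g_bilinear] bilinear_rmul[OF g_bilinear]
  bilinear_lsub[OF g_bilinear] bilinear_rsub[OF g_bilinear]
  bilinear_lneg[OF g_bilinear] bilinear_rneg[OF g_bilinear]

lemma K_sub: "subspace K" and K_br: "x \<in> K \<Longrightarrow> y \<in> K \<Longrightarrow> br x y \<in> K"
  using subalg by (auto simp: lie_subalgebra_def)

lemma K_nondeg: "y \<in> K \<Longrightarrow> (\<forall>z\<in>K. g y z = 0) \<Longrightarrow> y = 0"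
  using split orth by (intro g_nondeg) (metis add.right_neutral g_simps(2))

lemma m_nondeg:
  assumes "y \<in> m" "\<forall>z\<in>m. g y z = 0" shows "y = 0"
proof (rule g_nondeg)
  fix w
  obtain u v where "u \<in> K" "v \<in> m" "w = u + v" using split by blast
  then show "g y w = 0" using assms orth[of u y] by (simp add: g_simps g_sym[of y u])
qed

lemma K_inter_m: "x \<in> K \<Longrightarrow> x \<in> m \<Longrightarrow> x = 0"
  using orth K_nondeg g_sym by metis

text \<open>The right side is linear in \<open>W\<close>, so the nondegenerate \<open>g\<close>
  represents it by exactly one vector; this justifies the description in
  \<open>lc_nabla\<close>.\<close>

lemma lc_nabla_koszul:
  "2 * g (lc_nabla br g X Y) W = g (br X Y) W - g (br Y W) X + g (br W X) Y"
proof -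
  let ?\<phi> = "\<lambda>W. (g (br X Y) W - g (br Y W) X + g (br W X) Y) / 2"
  have "linear ?\<phi>"
    by (rule linearI) (simp_all add: g_simps br_add br_scale field_simps)
  then obtain Z where Z: "\<And>W. g Z W = ?\<phi> W"
    using nondegenerate_represents_functional[OF subspace_UNIV g_bilinear, of ?\<phi>] g_nondeg by auto
  have "\<exists>!Z. \<forall>W. 2 * g Z W = g (br X Y) W - g (br Y W) X + g (br W X) Y"
  proof (rule ex1I[of _ Z])
    show "\<forall>W. 2 * g Z W = g (br X Y) W - g (br Y W) X + g (br W X) Y"
    proof
      show "2 * g Z W = g (br X Y) W - g (br Y W) X + g (br W X) Y" for W
        unfolding Z by simp
    qed
    fix Z' assume Z': "\<forall>W. 2 * g Z' W = g (br X Y) W - g (br Y W) X + g (br W X) Y"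
    have "Z' - Z = 0"
    proof (rule g_nondeg)
      fix W
      have "2 * g Z' W = 2 * g Z W" unfolding Z Z'[rule_format] by simp
      then show "g (Z' - Z) W = 0" by (simp add: g_simps)
    qed
    then show "Z' = Z" by simp
  qed
  from theI'[OF this] show ?thesis unfolding lc_nabla_def by blast
qed

text \<open>In the Koszul formula symmetrized in \<open>E\<close> and \<open>F\<close> the terms
  with \<open>br E F\<close> cancel. What remains is the symmetric part of the action of
  \<open>W\<close> on \<open>m\<close>, which conformality makes a multiple of the metric.\<close>

lemma conformal_ad:
  obtains V where "\<And>W E F. W \<in> K \<Longrightarrow> E \<in> m \<Longrightarrow> F \<in> m \<Longrightarrow>
    g (br W E) F + g (br W F) E = 2 * g V W * g E F"
proof -
  obtain V where V: "V \<in> K" "\<And>E F. E \<in> m \<Longrightarrow> F \<in> m \<Longrightarrow> BH br g K E F = g E F *\<^sub>R V"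
    using conformal by (auto simp: conformal_foliation_def)
  have "g (br W E) F + g (br W F) E = 2 * g V W * g E F" if "W \<in> K" "E \<in> m" "F \<in> m" for W E F
  proof -
    let ?x = "lc_nabla br g E F + lc_nabla br g F E"
    obtain u v where uv: "u \<in> K" "v \<in> m" "?x = u + v" using split by blast
    have "orth_proj g K ?x = u"
      by (rule orth_proj_eqI[OF g_bilinear K_sub K_nondeg uv(1)])
        (use uv orth g_sym in auto)
    then have "(1 / 2) *\<^sub>R u = g E F *\<^sub>R V" using V(2)[OF that(2,3)] by (simp add: BH_def)
    then have "g ((1 / 2) *\<^sub>R u) W = g (g E F *\<^sub>R V) W" by simp
    then have "g u W = 2 * g E F * g V W" by (simp add: g_simps)
    moreover have "g ?x W = g u W" using uv orth[OF that(1) uv(2)] g_sym[of v W] by (simp add: g_simps)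
    moreover have "2 * g ?x W = 2 * (g (br W E) F + g (br W F) E)"
      using lc_nabla_koszul[of E F W] lc_nabla_koszul[of F E W] br_anti[of F E] br_anti[of F W] br_anti[of E W]
      by (simp add: g_simps)
    ultimately show ?thesis by (simp add: algebra_simps)
  qed
  then show ?thesis using that by blast
qed

section \<open>The horizontal projection and the action of \<open>K\<close> on the horizontal
  plane\<close>

definition hor :: "'a \<Rightarrow> 'a" where
  "hor z = (THE y. y \<in> m \<and> z - y \<in> K)"

lemma hor_eqI:
  assumes "y \<in> m" "z - y \<in> K" shows "hor z = y"
  unfolding hor_def
proof (rule the_equality)
  fix y' assume y': "y' \<in> m \<and> z - y' \<in> K"
  have "y' - y = (z - y) - (z - y')" by simp
  then have "y' - y \<in> K" using assms y' subspace_diff[OF K_sub] by metis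
  then have "y' - y = 0" using assms y' subspace_diff[OF m_sub] K_inter_m by blast
  then show "y' = y" by simp
qed (use assms in blast)

lemma hor_m: "hor z \<in> m" and hor_K: "z - hor z \<in> K"
proof -
  obtain x y where "x \<in> K" "y \<in> m" "z = x + y" using split by blast
  moreover then have "hor z = y" by (intro hor_eqI) auto
  ultimately show "hor z \<in> m" "z - hor z \<in> K" by auto
qed

lemma linear_hor: "linear hor"
proof (rule linearI)
  fix x y c
  have "(x + y) - (hor x + hor y) = (x - hor x) + (y - hor y)" by simp
  then show "hor (x + y) = hor x + hor y"
    using hor_m hor_K subspace_add[OF K_sub] subspace_add[OF m_sub] by (metis hor_eqI)
  have "c *\<^sub>R x - c *\<^sub>R hor x = c *\<^sub>R (x - hor x)" by (simp add: scaleR_diff_right)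
  then show "hor (c *\<^sub>R x) = c *\<^sub>R hor x"
    using hor_m hor_K subspace_scale[OF K_sub] subspace_scale[OF m_sub] by (metis hor_eqI)
qed

lemma hor_0: "z \<in> K \<Longrightarrow> hor z = 0"
  by (rule hor_eqI) (simp_all add: subspace_0[OF m_sub])

text \<open>Identifying \<open>m\<close> with the quotient by \<open>K\<close>, the map
  \<open>\<rho>\<close> is the action of \<open>K\<close> on that quotient. It consists of commuting
  endomorphisms, so it vanishes on brackets, and these span \<open>K\<close>.\<close>

lemma ad_preserves_K:
  assumes perfect: "derived K = K" and dim: "dim m = 2" and W: "W \<in> K" and x: "x \<in> m"
  shows "br W x \<in> K"
proof -
  obtain V where V: "\<And>W E F. W \<in> K \<Longrightarrow> E \<in> m \<Longrightarrow> F \<in> m \<Longrightarrow>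
    g (br W E) F + g (br W F) E = 2 * g V W * g E F"
    using conformal_ad by blast
  define \<rho> where "\<rho> W x = hor (br W x)" for W x
  have lin: "linear (\<rho> W)" for W
    unfolding \<rho>_def using linear_compose[OF linear_right linear_hor] by (simp add: comp_def)
  have g_hor: "g (hor z) F = g z F" if "F \<in> m" for z F
    using orth[OF hor_K[of z] that] by (simp add: g_simps)
  have conf: "g (\<rho> W E) F + g (\<rho> W F) E = 2 * g V W * g E F" if "W \<in> K" "E \<in> m" "F \<in> m" for W E F
    unfolding \<rho>_def using V[OF that] that by (simp add: g_hor)
  have comm: "\<rho> W (\<rho> W' x) = \<rho> W' (\<rho> W x)" if "W \<in> K" "W' \<in> K" "x \<in> m" for W W' x
  proof (rule plane_conformal_endomorphisms_commute[OF g_bilinear g_sym m_sub dim m_nondeg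
        lin[of W] _ _ lin[of W'] _ _ that(3)])
    show "\<rho> W y \<in> m" "\<rho> W' y \<in> m" for y unfolding \<rho>_def by (rule hor_m)+
    show "g (\<rho> W y) z + g (\<rho> W z) y = 2 * g V W * g y z" if "y \<in> m" "z \<in> m" for y z
      using conf \<open>W \<in> K\<close> that by blast
    show "g (\<rho> W' y) z + g (\<rho> W' z) y = 2 * g V W' * g y z" if "y \<in> m" "z \<in> m" for y z
      using conf \<open>W' \<in> K\<close> that by blast
  qed
  \<comment> \<open>The vertical part of \<open>br W' x\<close> may be dropped because
    \<open>K\<close> is closed under brackets.\<close>
  have hom: "hor (br W (br W' x)) = \<rho> W (\<rho> W' x)" if "W \<in> K" for W W' x
  proof -
    have "br W (br W' x) = br W (br W' x - hor (br W' x)) + br W (hor (br W' x))"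
      unfolding br_diff by simp
    then show ?thesis
      using hor_0[OF K_br[OF that hor_K[of "br W' x"]]] linear_add[OF linear_hor]
      unfolding \<rho>_def by (metis add_0)
  qed
  have "W \<in> derived K" using W perfect by simp
  then have "hor (br W x) = 0"
  proof (induction rule: span_induct_alt)
    case base
    show ?case using linear_0[OF linear_hor] by (simp add: br_zero)
  next
    case (step c y z)
    obtain a b where ab: "y = br a b" "a \<in> K" "b \<in> K" using step by auto
    have "br y x = br a (br b x) - br b (br a x)" unfolding ab using br_leibniz[of a b x] by simp
    then have "hor (br y x) = 0"
      using hom ab comm[OF ab(2,3) x] by (simp add: linear_diff[OF linear_hor])
    then show ?case using step
      by (simp add: br_add br_scale linear_add[OF linear_hor] linear_scale[OF linear_hor])
  qed
  then show ?thesis using hor_K[of "br W x"] by simp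
qed

end

section \<open>Stability of each factor under brackets with horizontal vectors\<close>

theorem theorem6p2:
  fixes br :: "'a::euclidean_space \<Rightarrow> 'a \<Rightarrow> 'a"
    and g :: "'a \<Rightarrow> 'a \<Rightarrow> real"
    and k :: "nat \<Rightarrow> 'a set" and m :: "'a set" and n :: nat
  assumes lie: "lie_algebra br"
    and metric: "semi_riem_metric g"
    and sub: "\<And>j. j < n \<Longrightarrow> lie_subalgebra br (k j)"
    and prod: "\<And>i j x y. i < n \<Longrightarrow> j < n \<Longrightarrow> i \<noteq> j \<Longrightarrow> x \<in> k i \<Longrightarrow> y \<in> k j \<Longrightarrow> br x y = 0"
    and semisimple: "semisimple_lie br (sum_spaces k n)"
    and m_sub: "subspace m" and m_dim: "dim m = 2"
    and orth_kk: "\<And>i j x y. i < n \<Longrightarrow> j < n \<Longrightarrow> i \<noteq> j \<Longrightarrow> x \<in> k i \<Longrightarrow> y \<in> k j \<Longrightarrow> g x y = 0"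
    and orth_km: "\<And>j x y. j < n \<Longrightarrow> x \<in> k j \<Longrightarrow> y \<in> m \<Longrightarrow> g x y = 0"
    and spans: "\<And>z. \<exists>xs y. (\<forall>j<n. xs j \<in> k j) \<and> y \<in> m \<and> z = (\<Sum>j<n. xs j) + y"
    and direct: "\<And>xs y. (\<forall>j<n. xs j \<in> k j) \<Longrightarrow> y \<in> m \<Longrightarrow> (\<Sum>j<n. xs j) + y = 0 \<Longrightarrow>
                   (\<forall>j<n. xs j = 0) \<and> y = 0"
    and conformal: "conformal_foliation br g (sum_spaces k n) m"
  shows "\<forall>j<n. \<forall>l<n. j \<noteq> l \<longrightarrow> (\<forall>E\<in>k l. \<forall>F\<in>m. orth_proj g (k j) (br E F) = 0)"
proof -
  let ?K = "sum_spaces k n"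
  have bil: "bilinear g" using metric by (simp add: semi_riem_metric_def)
  have K_elim: "\<exists>xs. (\<forall>j<n. xs j \<in> k j) \<and> u = (\<Sum>j<n. xs j)" if "u \<in> ?K" for u
    using that by (auto simp: sum_spaces_def)
  have orth_Km: "g x y = 0" if "x \<in> ?K" "y \<in> m" for x y
  proof -
    obtain xs where "\<forall>j<n. xs j \<in> k j" "x = (\<Sum>j<n. xs j)" using K_elim[OF \<open>x \<in> ?K\<close>] by blast
    moreover have "linear (\<lambda>x. g x y)" using bil by (simp add: bilinear_def)
    ultimately show ?thesis
      using orth_km \<open>y \<in> m\<close> linear_sum[of "\<lambda>x. g x y" xs "{..<n}"] by simp
  qed
  interpret conformal_splitting br g ?K m
  proof unfold_locales
    show "\<exists>x\<in>?K. \<exists>y\<in>m. z = x + y" for z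
      using spans[of z] by (auto simp: sum_spaces_def)
  qed (use lie metric semisimple m_sub orth_Km conformal in \<open>auto simp: semisimple_lie_def\<close>)
  have perfect: "derived ?K = ?K" using semisimple_perfect[OF semisimple] .
  have ksub: "subspace (k j)" and kbr: "\<And>x y. x \<in> k j \<Longrightarrow> y \<in> k j \<Longrightarrow> br x y \<in> k j"
    if "j < n" for j
    using sub[OF that] by (auto simp: lie_subalgebra_def)
  have single: "(\<Sum>i<n. if i = j then x else 0) = x" if "j < n" for j and x :: 'a
    using that by simp
  have k_K: "x \<in> ?K" if "j < n" "x \<in> k j" for j x
    unfolding sum_spaces_def using single[OF that(1), of x] that subspace_0[OF ksub]
    by (auto intro!: exI[of _ "\<lambda>i. if i = j then x else 0"])
  \<comment> \<open>Each factor is an ideal of the product, as distinct factors commute.\<close>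
  have br_K: "br u b \<in> k l" if "u \<in> ?K" "l < n" "b \<in> k l" for u l b
  proof -
    obtain xs where xs: "\<forall>j<n. xs j \<in> k j" "u = (\<Sum>j<n. xs j)" using K_elim[OF \<open>u \<in> ?K\<close>] by blast
    have "br u b = (\<Sum>j<n. br (xs j) b)" unfolding xs(2) br_sum ..
    also have "\<dots> = (\<Sum>j<n. if j = l then br (xs l) b else 0)"
      using prod[OF _ that(2) _ _ that(3)] xs(1) by (intro sum.cong) auto
    finally show ?thesis using kbr that xs(1) by simp
  qed
  \<comment> \<open>Perfectness descends to the factors: mixed brackets vanish, so \<open>x\<close>
    is a sum of elements of the derived algebras of the factors.\<close>
  have k_perfect: "x \<in> derived (k l)" if l: "l < n" and x: "x \<in> k l" for l x
  proof -
    let ?P = "\<lambda>z xs. (\<forall>j<n. xs j \<in> derived (k j)) \<and> z = (\<Sum>j<n. xs j)"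
    have "x \<in> derived ?K" using k_K[OF l x] perfect by simp
    then have "\<exists>xs. ?P x xs"
    proof (induction rule: span_induct_alt)
      case base
      show ?case by (rule exI[of _ "\<lambda>_. 0"]) (simp add: span_zero)
    next
      case (step c y z)
      obtain zs where zs: "?P z zs" using step by blast
      obtain u v where uv: "y = br u v" "u \<in> ?K" "v \<in> ?K" using step by auto
      obtain us where us: "\<forall>j<n. us j \<in> k j" "u = (\<Sum>j<n. us j)" using K_elim[OF uv(2)] by blast
      obtain vs where vs: "\<forall>j<n. vs j \<in> k j" "v = (\<Sum>j<n. vs j)" using K_elim[OF uv(3)] by blast
      have "y = (\<Sum>j<n. \<Sum>i<n. br (us i) (vs j))"
        unfolding uv us(2) vs(2) br_sum(2) br_sum(1) ..
      also have "\<dots> = (\<Sum>j<n. br (us j) (vs j))"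
      proof (rule sum.cong[OF refl])
        fix j assume j: "j \<in> {..<n}"
        have "(\<Sum>i<n. br (us i) (vs j)) = (\<Sum>i<n. if i = j then br (us j) (vs j) else 0)"
          using prod us(1) vs(1) j by (intro sum.cong) auto
        then show "(\<Sum>i<n. br (us i) (vs j)) = br (us j) (vs j)" using j by simp
      qed
      finally have "c *\<^sub>R y + z = (\<Sum>j<n. c *\<^sub>R br (us j) (vs j) + zs j)"
        using zs by (simp add: sum.distrib scaleR_sum_right)
      moreover have "c *\<^sub>R br (us j) (vs j) + zs j \<in> derived (k j)" if "j < n" for j
      proof (intro span_add span_scale)
        show "br (us j) (vs j) \<in> derived (k j)"
          using us(1) vs(1) that by (intro span_base) blast
        show "zs j \<in> derived (k j)" using zs that by blast
      qed
      ultimately show ?case by (intro exI[of _ "\<lambda>j. c *\<^sub>R br (us j) (vs j) + zs j"]) simp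
    qed
    then obtain xs where xs: "?P x xs" by blast
    have xs_k: "xs j \<in> k j" if "j < n" for j
      using xs that lie_subalgebra_derived(2)[OF sub[OF that]] by blast
    \<comment> \<open>The difference of two decompositions of \<open>x\<close>; directness of the
      sum makes it zero, so \<open>x\<close> equals \<open>xs l\<close>.\<close>
    let ?d = "\<lambda>j. xs j - (if j = l then x else 0)"
    have "(\<Sum>j<n. ?d j) + 0 = 0" using xs single[OF l, of x] by (simp add: sum_subtractf)
    moreover have "\<forall>j<n. ?d j \<in> k j"
      using xs_k x subspace_diff[OF ksub] by auto
    ultimately have "?d l = 0" using direct[of ?d 0] subspace_0[OF m_sub] l by blast
    then show ?thesis using xs l by auto
  qed
  \<comment> \<open>For \<open>E\<close> a bracket of \<open>a\<close> and \<open>b\<close> in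
    \<open>k l\<close>, the Leibniz rule leaves brackets of \<open>b\<close> and \<open>a\<close>
    with elements of \<open>?K\<close>, which stay in the ideal \<open>k l\<close>.\<close>
  have stable: "br E F \<in> k l" if l: "l < n" and E: "E \<in> k l" and F: "F \<in> m" for l E F
    using k_perfect[OF l E]
  proof (induction rule: span_induct_alt)
    case base
    show ?case using subspace_0[OF ksub[OF l]] by (simp add: br_zero)
  next
    case (step c y z)
    obtain a b where ab: "y = br a b" "a \<in> k l" "b \<in> k l" using step by auto
    have FK: "br a F \<in> ?K" "br b F \<in> ?K"
      using ad_preserves_K[OF perfect m_dim _ F] k_K[OF l] ab by auto
    have "br y F = br a (br b F) - br b (br a F)" unfolding ab using br_leibniz[of a b F] by simp
    also have "\<dots> = br (br a F) b - br (br b F) a"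
      using br_anti[of a "br b F"] br_anti[of b "br a F"] by simp
    also have "\<dots> \<in> k l"
      using br_K[OF FK(1) l ab(3)] br_K[OF FK(2) l ab(2)] subspace_diff[OF ksub[OF l]] by blast
    finally show ?case using step subspace_add[OF ksub[OF l]] subspace_scale[OF ksub[OF l]]
      by (simp add: br_add br_scale)
  qed
  \<comment> \<open>Nondegeneracy on the single factor makes the vector described by
    \<open>orth_proj g (k j)\<close> unique.\<close>
  have k_nondeg: "y = 0" if j: "j < n" and y: "y \<in> k j" "\<forall>z\<in>k j. g y z = 0" for j y
  proof (rule K_nondeg[OF k_K[OF j y(1)]], rule ballI)
    fix w assume "w \<in> ?K"
    then obtain ws where ws: "\<forall>i<n. ws i \<in> k i" "w = (\<Sum>i<n. ws i)" using K_elim by blast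
    have "g y (ws i) = 0" if "i < n" for i
      using y ws(1) that orth_kk[OF j that _ y(1)] by (cases "i = j") auto
    moreover have "linear (g y)" using bil by (simp add: bilinear_def)
    ultimately show "g y w = 0" unfolding ws(2) using linear_sum[of "g y" ws "{..<n}"] by simp
  qed
  show ?thesis
  proof (intro allI impI ballI)
    fix j l E F assume jl: "j < n" "l < n" "j \<noteq> l" and E: "E \<in> k l" and F: "F \<in> m"
    show "orth_proj g (k j) (br E F) = 0"
      by (rule orth_proj_eqI[OF bil ksub[OF jl(1)] k_nondeg[OF jl(1)]])
        (use stable[OF jl(2) E F] jl orth_kk subspace_0[OF ksub[OF jl(1)]] in auto)
  qed
qed

end
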